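(* Let $f:\Omega\to\mathbb{R}_m$ be a function. The following assertions are equivalent. \begin{itemize} \item[(a)] $f\in\mathcal{SM}(\Omega,\mathbb{R}_m)$, i.e., $f$ is slice monogenic. \item[(a$'$)] $f\in\mathscr{C}^1_{\mathrm{sl}}(\Omega,\mathbb{R}_m)$ and $\overline{\partial}_I f_I=0$ on $\Omega_I$ for all $I\in\mathbb{S}^{m-1}$. \item[(b)] $f\in\mathscr{C}^0(\Omega,\mathbb{R}_m)$, $f_*\in\mathscr{C}^1(\Omega_*,\mathbb{R}_m)$ and $f_*\in\ker(\overline{\vartheta}_m)$. \item[(b$'$)] $f\in\mathscr{C}^0_{\mathrm{sl}}(\Omega,\mathbb{R}_m)$, $f_*\in\mathscr{C}^1(\Omega_*,\mathbb{R}_m)$ and $f_*\in\ker(\overline{\vartheta}_m)$. \item[(c)] $f\in\mathscr{C}^1(\Omega,\mathbb{R}_m)$ and $f_*\in\ker(\overline{\vartheta}_m)$. \item[(d)] $f\in\mathscr{C}^1(\Omega,\mathbb{R}_m)$ and $f\in\ker(G_m)$. \item[(e)] $f\in\mathcal{S}^1(\Omega,\mathbb{R}_m)$ and $\frac{\partial f}{\partial x^c}=0$ on $\Omega$. \end{itemize}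
   Context: Fix an integer $m\geq2$. $\mathbb{R}_m=C\ell_{0,m}$ is the real Clifford algebra (of dimension $2^m$) generated by $e_1,\ldots,e_m$ with $e_j^2=-1$ and $e_je_k=-e_ke_j$ for $j\neq k$. $\mathbb{R}^{m+1}\subset\mathbb{R}_m$ is the subspace of paravectors $x=x_0+\sum_{j=1}^mx_je_j$, with $x_j\in\mathbb{R}$; $\mathrm{Im}(x)=\sum_{j=1}^mx_je_j$, $|\mathrm{Im}(x)|=(\sum_{j=1}^mx_j^2)^{1/2}$. $\mathbb{S}^{m-1}=\{x\in\mathbb{R}^{m+1}:x^2=-1\}$ and, for $I\in\mathbb{S}^{m-1}$, $\mathbb{C}_I=\{\alpha+I\beta:\alpha,\beta\in\mathbb{R}\}\subset\mathbb{R}^{m+1}$. A subset of $\mathbb{R}^{m+1}$ is circular if it has the form $\Omega_{m,E}=\{\alpha+I\beta:\alpha,\beta\in\mathbb{R},\ \alpha+i\beta\in E,\ I\in\mathbb{S}^{m-1}\}$ for some $E\subset\mathbb{C}$. Fixed throughout: $\Omega$ is a non-empty connected circular open subset of $\mathbb{R}^{m+1}$ with $\Omega\cap\mathbb{R}\neq\emptyset$, and $D\subset\mathbb{C}$ is the (non-empty, open, conjugation-invariant) set with $\Omega=\Omega_{m,D}$, i.e. $D=\{\alpha+i\beta:\alpha+I\beta\in\Omega\text{ for all }I\in\mathbb{S}^{m-1}\}$. Put $\Omega_I=\Omega\cap\mathbb{C}_I$, $\phi_I:D\to\Omega_I$, $\phi_I(\alpha+i\beta)=\alpha+I\beta$;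 $f_I=f|_{\Omega_I}$; $\Omega_*=\Omega\setminus\mathbb{R}$, $f_*=f|_{\Omega_*}$. For an open $O\subset\mathbb{R}^{m+1}$, $\mathscr{C}^0(O,\mathbb{R}_m)$ and $\mathscr{C}^1(O,\mathbb{R}_m)$ are the sets of continuous, respectively $\mathscr{C}^1$ (in the real sense), functions $O\to\mathbb{R}_m$. $\mathscr{C}^0_{\mathrm{sl}}(\Omega,\mathbb{R}_m)$ is the set of $f:\Omega\to\mathbb{R}_m$ with $f_I$ continuous for every $I\in\mathbb{S}^{m-1}$; $\mathscr{C}^1_{\mathrm{sl}}(\Omega,\mathbb{R}_m)$ is the set of $f:\Omega\to\mathbb{R}_m$ with $f_I\circ\phi_I:D\to\mathbb{R}_m$ of class $\mathscr{C}^1$ for every $I\in\mathbb{S}^{m-1}$. If $g:\Omega_I\to\mathbb{R}_m$ is such that $g\circ\phi_I$ is $\mathscr{C}^1$, then $\overline{\partial}_I g(x)=\frac12\Big(\big(\frac{\partial}{\partial\alpha}+I\frac{\partial}{\partial\beta}\big)(g\circ\phi_I)\Big)(\phi_I^{-1}(x))$. The function $f$ is slice monogenic if $f\in\mathscr{C}^1(\Omega,\mathbb{R}_m)$ and $\overline{\partial}_I f_I=0$ on $\Omega_I$ for all $I\in\mathbb{S}^{m-1}$; $\mathcal{SM}(\Omega,\mathbb{R}_m)$ is the set of such functions. The operators $\overline{\vartheta}_m:\mathscr{C}^1(\Omega_*,\mathbb{R}_m)\to\mathscr{C}^0(\Omega_*,\mathbb{R}_m)$ and $G_m:\mathscr{C}^1(\Omega,\mathbb{R}_m)\to\mathscr{C}^0(\Omega,\mathbb{R}_m)$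 are $$\overline{\vartheta}_m=\frac12\Big(\frac{\partial}{\partial x_0}+\frac{\mathrm{Im}(x)}{|\mathrm{Im}(x)|^2}\sum_{h=1}^mx_h\frac{\partial}{\partial x_h}\Big),\qquad G_m=|\mathrm{Im}(x)|^2\frac{\partial}{\partial x_0}+\mathrm{Im}(x)\sum_{h=1}^mx_h\frac{\partial}{\partial x_h}$$ (Clifford factors multiply on the left). A stem function is $F=F_1+iF_2:D\to\mathbb{R}_m\otimes_{\mathbb{R}}\mathbb{C}$ ($F_1,F_2:D\to\mathbb{R}_m$) with $F_1(\overline z)=F_1(z)$, $F_2(\overline z)=-F_2(z)$. It induces the slice function $f=\mathcal{I}(F):\Omega\to\mathbb{R}_m$, $f(\alpha+I\beta)=F_1(\alpha+i\beta)+IF_2(\alpha+i\beta)$ for all $\alpha+i\beta\in D$, $I\in\mathbb{S}^{m-1}$; $F$ is uniquely determined by $f$. $\mathcal{S}^1(\Omega,\mathbb{R}_m)$ is the set of slice functions induced by stem functions with $F_1,F_2$ of class $\mathscr{C}^1$. For $f=\mathcal{I}(F)\in\mathcal{S}^1(\Omega,\mathbb{R}_m)$, $\frac{\partial f}{\partial x^c}=\mathcal{I}\big(\frac{\partial F}{\partial\overline z}\big)$, where $\frac{\partial F}{\partial\overline z}=\frac12\Big(\big(\frac{\partial F_1}{\partial\alpha}-\frac{\partial F_2}{\partial\beta}\big)+i\big(\frac{\partial F_1}{\partial\beta}+\frac{\partial F_2}{\partial\alpha}\big)\Big)$ (again a stem function). *)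

theory Defs
  imports "HOL-Analysis.Analysis"
begin

section \<open>The real Clifford algebra with negative definite generators\<close>

text \<open>
  An element is given by its coordinates with respect to the basis of blades
  \<open>e\<^sub>A = e\<^bsub>a1\<^esub> \<dots> e\<^bsub>ak\<^esub>\<close>, where \<open>A = {a1 < \<dots> < ak}\<close> ranges over the subsets of the
  index type. For an index type with \<open>m\<close> elements this is the algebra
  on \<open>m\<close> generators, of dimension \<open>2 ^ m\<close>; the order on the index type only fixes the
  enumeration of the generators.
\<close>

typedef 'n clifford = "UNIV :: ('n set \<Rightarrow> real) set"
  morphisms blade_coeff Clifford ..

lemma blade_coeff_Clifford [simp]: "blade_coeff (Clifford c) A = c A"
  by (simp add: Clifford_inverse)

lemma clifford_eq_iff: "x = y \<longleftrightarrow> (\<forall>A. blade_coeff x A = blade_coeff y A)"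
  by (metis blade_coeff_inject ext)

subsection \<open>Euclidean structure: the blades are orthonormal\<close>

instantiation clifford :: (type) real_vector
begin

definition "0 = Clifford (\<lambda>A. 0)"
definition "x + y = Clifford (\<lambda>A. blade_coeff x A + blade_coeff y A)"
definition "- x = Clifford (\<lambda>A. - blade_coeff x A)"
definition "x - y = Clifford (\<lambda>A. blade_coeff x A - blade_coeff y A)"
definition "r *\<^sub>R x = Clifford (\<lambda>A. r * blade_coeff x A)"

instance
  by standard
    (simp_all add: clifford_eq_iff zero_clifford_def plus_clifford_def uminus_clifford_def
      minus_clifford_def scaleR_clifford_def algebra_simps)

end

lemma blade_coeff_simps [simp]:
  "blade_coeff 0 A = 0"
  "blade_coeff (x + y) A = blade_coeff x A + blade_coeff y A"
  "blade_coeff (- x) A = - blade_coeff x A"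
  "blade_coeff (x - y) A = blade_coeff x A - blade_coeff y A"
  "blade_coeff (r *\<^sub>R x) A = r * blade_coeff x A"
  by (simp_all add: zero_clifford_def plus_clifford_def uminus_clifford_def
      minus_clifford_def scaleR_clifford_def)

definition blade :: "'n set \<Rightarrow> 'n clifford" where
  "blade A = Clifford (\<lambda>B. if B = A then 1 else 0)"

abbreviation generator :: "'n \<Rightarrow> 'n clifford" where
  "generator j \<equiv> blade {j}"

lemma blade_coeff_blade [simp]: "blade_coeff (blade A) B = (if B = A then 1 else 0)"
  by (simp add: blade_def)

lemma inj_blade: "inj blade"
  by (rule injI) (metis blade_coeff_blade zero_neq_one)

instantiation clifford :: (finite) euclidean_space
begin

definition inner_clifford :: "'a clifford \<Rightarrow> 'a clifford \<Rightarrow> real" where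
  "inner_clifford x y = (\<Sum>A\<in>UNIV. blade_coeff x A * blade_coeff y A)"
definition norm_clifford :: "'a clifford \<Rightarrow> real" where
  "norm_clifford x = sqrt (inner x x)"
definition sgn_clifford :: "'a clifford \<Rightarrow> 'a clifford" where
  "sgn_clifford x = x /\<^sub>R norm x"
definition dist_clifford :: "'a clifford \<Rightarrow> 'a clifford \<Rightarrow> real" where
  "dist_clifford x y = norm (x - y)"
definition uniformity_clifford :: "('a clifford \<times> 'a clifford) filter" where
  "uniformity_clifford = (INF e\<in>{0<..}. principal {(x, y). dist x y < e})"
definition open_clifford :: "'a clifford set \<Rightarrow> bool" where
  "open_clifford U \<longleftrightarrow> (\<forall>x\<in>U. \<forall>\<^sub>F (x', y) in uniformity. x' = x \<longrightarrow> y \<in> U)"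
definition Basis_clifford :: "'a clifford set" where
  "Basis_clifford = range blade"

instance
proof
  fix x y z :: "'a clifford" and r :: real and U :: "'a clifford set"
  show "dist x y = norm (x - y)"
    by (rule dist_clifford_def)
  show "sgn x = x /\<^sub>R norm x"
    by (rule sgn_clifford_def)
  show "uniformity = (INF e\<in>{0<..}. principal {(x, y :: 'a clifford). dist x y < e})"
    by (rule uniformity_clifford_def)
  show "open U \<longleftrightarrow> (\<forall>x\<in>U. \<forall>\<^sub>F (x', y) in uniformity. x' = x \<longrightarrow> y \<in> U)"
    by (rule open_clifford_def)
  show "inner x y = inner y x"
    by (simp add: inner_clifford_def mult.commute)
  show "inner (x + y) z = inner x z + inner y z"
    by (simp add: inner_clifford_def algebra_simps sum.distrib)
  show "inner (r *\<^sub>R x) y = r * inner x y"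
    by (simp add: inner_clifford_def sum_distrib_left mult.assoc)
  show "0 \<le> inner x x"
    by (simp add: inner_clifford_def sum_nonneg)
  show "inner x x = 0 \<longleftrightarrow> x = 0"
    by (simp add: inner_clifford_def sum_nonneg_eq_0_iff clifford_eq_iff)
  show "norm x = sqrt (inner x x)"
    by (rule norm_clifford_def)
  show "(Basis :: 'a clifford set) \<noteq> {}" "finite (Basis :: 'a clifford set)"
    by (simp_all add: Basis_clifford_def)
  have inner_blade: "inner w (blade A) = blade_coeff w A" for w :: "'a clifford" and A
    by (simp add: inner_clifford_def if_distrib cong: if_cong)
  show "inner u v = (if u = v then 1 else 0)"
    if "u \<in> Basis" "v \<in> Basis" for u v :: "'a clifford"
    using that inj_blade by (auto simp: Basis_clifford_def inner_blade inj_eq)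
  show "(\<forall>u\<in>Basis. inner x u = 0) \<longleftrightarrow> x = 0"
    by (auto simp: Basis_clifford_def inner_blade clifford_eq_iff)
qed

end

lemma DIM_clifford: "DIM('n::finite clifford) = 2 ^ CARD('n)"
proof -
  have "DIM('n clifford) = card (UNIV :: 'n set set)"
    by (simp add: Basis_clifford_def card_image inj_blade)
  then show ?thesis
    by (metis Pow_UNIV card_Pow finite)
qed

subsection \<open>Multiplication\<close>

text \<open>
  \<open>e\<^sub>A e\<^sub>B = \<plusminus>e\<^sub>C\<close> with \<open>C\<close> the symmetric difference: a factor \<open>-1\<close> arises for each
  \<open>a \<in> A\<close>, \<open>b \<in> B\<close> with \<open>b < a\<close> from sorting, and for each common element from \<open>e\<^sub>a\<^sup>2 = -1\<close>.
\<close>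

definition blade_sign :: "'n::linorder set \<Rightarrow> 'n set \<Rightarrow> real" where
  "blade_sign A B = (\<Prod>a\<in>A. \<Prod>b\<in>B. if b \<le> a then -1 else 1)"

lemma prod_sym_diff:
  fixes g :: "'a \<Rightarrow> real"
  assumes "finite A" "finite B" and sq: "\<And>a. g a * g a = 1"
  shows "prod g (sym_diff A B) = prod g A * prod g B"
proof -
  have "prod g A = prod g (A \<inter> B) * prod g (A - B)"
    using \<open>finite A\<close> by (rule prod.Int_Diff)
  moreover have "prod g B = prod g (A \<inter> B) * prod g (B - A)"
    using prod.Int_Diff[OF \<open>finite B\<close>, of g A] by (simp add: Int_commute)
  moreover have "prod g (A \<inter> B) * prod g (A \<inter> B) = 1"
    by (simp add: prod.distrib[symmetric] sq)
  moreover have "prod g (sym_diff A B) = prod g (A - B) * prod g (B - A)"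
    using assms by (intro prod.union_disjoint) auto
  ultimately show ?thesis
    by (simp add: mult.left_commute mult.assoc)
qed

lemma blade_sign_sq: "blade_sign A B * blade_sign A B = 1"
  unfolding blade_sign_def by (simp add: prod.distrib[symmetric] if_distrib cong: if_cong)

lemma blade_sign_sq_left: "blade_sign A B * (blade_sign A B * r) = r"
  by (simp add: blade_sign_sq mult.assoc[symmetric])

lemma blade_sign_sym_diff_left:
  fixes A B C :: "'n::{finite,linorder} set"
  shows "blade_sign (sym_diff A B) C = blade_sign A C * blade_sign B C"
  unfolding blade_sign_def
  by (rule prod_sym_diff) (simp_all add: prod.distrib[symmetric] if_distrib cong: if_cong)

lemma blade_sign_sym_diff_right:
  fixes A B C :: "'n::{finite,linorder} set"
  shows "blade_sign A (sym_diff B C) = blade_sign A B * blade_sign A C"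
  unfolding blade_sign_def prod.distrib[symmetric]
  by (intro prod.cong refl prod_sym_diff) simp_all

lemma blade_sign_empty [simp]: "blade_sign {} A = 1" "blade_sign A {} = 1"
  by (simp_all add: blade_sign_def)

instantiation clifford :: ("{finite,linorder}") real_algebra_1
begin

definition one_clifford :: "'a clifford" where
  "1 = blade {}"

definition times_clifford :: "'a clifford \<Rightarrow> 'a clifford \<Rightarrow> 'a clifford" where
  "x * y = Clifford (\<lambda>C. \<Sum>A\<in>UNIV.
     blade_sign A (sym_diff A C) * blade_coeff x A * blade_coeff y (sym_diff A C))"

instance
proof
  fix x y z :: "'a clifford" and r :: real
  have coeff_mult: "blade_coeff (u * v) C = (\<Sum>A\<in>UNIV.
      blade_sign A (sym_diff A C) * blade_coeff u A * blade_coeff v (sym_diff A C))"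
    for u v :: "'a clifford" and C
    by (simp add: times_clifford_def)
  show "x * y * z = x * (y * z)"
    unfolding clifford_eq_iff
  proof
    fix D :: "'a set"
    let ?c = "\<lambda>A B. blade_coeff x A * blade_coeff y (sym_diff A B) * blade_coeff z (sym_diff B D)"
    have "blade_coeff (x * y * z) D = (\<Sum>B\<in>UNIV. \<Sum>A\<in>UNIV.
        blade_sign B (sym_diff B D) * blade_sign A (sym_diff A B) * ?c A B)"
      by (simp add: coeff_mult sum_distrib_left sum_distrib_right mult_ac)
    also have "\<dots> = (\<Sum>A\<in>UNIV. \<Sum>B\<in>UNIV.
        blade_sign B (sym_diff B D) * blade_sign A (sym_diff A B) * ?c A B)"
      by (rule sum.swap)
    also have "\<dots> = (\<Sum>A\<in>UNIV. \<Sum>B\<in>UNIV.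
        blade_sign A (sym_diff A D) * blade_sign (sym_diff A B) (sym_diff B D) * ?c A B)"
      by (intro sum.cong refl)
        (simp add: blade_sign_sym_diff_left blade_sign_sym_diff_right blade_sign_sq
          blade_sign_sq_left mult_ac)
    also have "\<dots> = (\<Sum>A\<in>UNIV. \<Sum>B\<in>UNIV.
        blade_sign A (sym_diff A D) * blade_sign B (sym_diff B (sym_diff A D)) *
        (blade_coeff x A * blade_coeff y B * blade_coeff z (sym_diff B (sym_diff A D))))"
    proof (rule sum.cong[OF refl])
      fix A :: "'a set"
      have shift: "sym_diff (sym_diff A B) (sym_diff A D) = sym_diff B D"
        and invol: "sym_diff A (sym_diff A B) = B" for B
        by auto
      show "(\<Sum>B\<in>UNIV. blade_sign A (sym_diff A D) * blade_sign (sym_diff A B) (sym_diff B D) *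
          ?c A B) = (\<Sum>B\<in>UNIV.
        blade_sign A (sym_diff A D) * blade_sign B (sym_diff B (sym_diff A D)) *
        (blade_coeff x A * blade_coeff y B * blade_coeff z (sym_diff B (sym_diff A D))))"
        by (rule sum.reindex_bij_witness[where i = "sym_diff A" and j = "sym_diff A"])
          (simp_all only: shift invol UNIV_I)
    qed
    also have "\<dots> = blade_coeff (x * (y * z)) D"
      by (simp only: coeff_mult sum_distrib_left mult_ac)
    finally show "blade_coeff (x * y * z) D = blade_coeff (x * (y * z)) D" .
  qed
  show "1 * x = x"
    by (simp add: clifford_eq_iff coeff_mult one_clifford_def if_distrib if_distribR
        cong: if_cong)
  show "x * 1 = x"
  proof -
    have "sym_diff A C = {} \<longleftrightarrow> A = C" for A C :: "'a set"
      by auto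
    then have "blade_coeff (x * 1) C = (\<Sum>A\<in>UNIV. if A = C then blade_coeff x A else 0)" for C
      unfolding coeff_mult one_clifford_def by (intro sum.cong) auto
    then show ?thesis
      by (simp add: clifford_eq_iff)
  qed
  show "(x + y) * z = x * z + y * z" "x * (y + z) = x * y + x * z"
    by (simp_all add: clifford_eq_iff coeff_mult algebra_simps sum.distrib)
  show "r *\<^sub>R x * y = r *\<^sub>R (x * y)" "x * r *\<^sub>R y = r *\<^sub>R (x * y)"
    by (simp_all add: clifford_eq_iff coeff_mult sum_distrib_left mult_ac)
  show "(0 :: 'a clifford) \<noteq> 1"
    by (auto simp: clifford_eq_iff one_clifford_def)
qed

end

lemma blade_mult_blade: "blade A * blade B = blade_sign A B *\<^sub>R blade (sym_diff A B)"
proof -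
  have *: "sym_diff A C = B \<longleftrightarrow> C = sym_diff A B" for C
    by auto
  have "blade_coeff (blade A * blade B) C = (\<Sum>A'\<in>UNIV. if A' = A then
      blade_sign A (sym_diff A C) * blade_coeff (blade B) (sym_diff A C) else 0)" for C
    unfolding times_clifford_def blade_coeff_Clifford by (intro sum.cong) auto
  then show ?thesis
    by (simp add: clifford_eq_iff * blade_sign_sym_diff_right blade_sign_sq_left)
qed

lemma generator_sq: "generator j * generator j = - 1"
  by (simp add: blade_mult_blade blade_sign_def one_clifford_def)

lemma generator_anticommute:
  assumes "j \<noteq> k"
  shows "generator j * generator k = - (generator k * generator j)"
proof -
  have "sym_diff {j} {k} = {j, k}" "sym_diff {k} {j} = {j, k}"
    using assms by auto
  then show ?thesis
    using assms by (auto simp: blade_mult_blade blade_sign_def)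
qed

lemma blade_insert:
  assumes "\<And>b. b \<in> A \<Longrightarrow> a < b"
  shows "blade (insert a A) = generator a * blade A"
proof -
  have "a \<notin> A" using assms by blast
  then have "sym_diff {a} A = insert a A" by auto
  moreover have "blade_sign {a} A = 1"
    using assms by (auto simp: blade_sign_def not_le intro!: prod.neutral)
  ultimately show ?thesis by (simp add: blade_mult_blade)
qed

section \<open>Paravectors and circular sets\<close>

text \<open>
  The paravector \<open>x\<^sub>0 + \<Sum>\<^sub>j x\<^sub>j e\<^sub>j\<close> is represented by the pair of \<open>x\<^sub>0\<close> and \<open>(x\<^sub>j)\<^sub>j\<close>, so
  that open sets and derivatives refer to the Euclidean space of paravectors itself; \<open>cl\<close> is
  the inclusion into the Clifford algebra.
\<close>

type_synonym 'n paravector = "real \<times> (real ^ 'n)"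

definition cl :: "'n::{finite,linorder} paravector \<Rightarrow> 'n clifford" where
  "cl x = of_real (fst x) + (\<Sum>j\<in>UNIV. (snd x $ j) *\<^sub>R generator j)"

definition im_part :: "'n::finite paravector \<Rightarrow> 'n paravector" where
  "im_part x = (0, snd x)"

definition real_paravectors :: "'n::finite paravector set" where
  "real_paravectors = range (\<lambda>r. (r, 0))"

definition imag_units :: "'n::{finite,linorder} paravector set" where
  "imag_units = {x. cl x * cl x = - 1}"

definition slice_map :: "'n::finite paravector \<Rightarrow> complex \<Rightarrow> 'n paravector" where
  "slice_map I z = (Re z, 0) + Im z *\<^sub>R I"

definition slice_plane :: "'n::finite paravector \<Rightarrow> 'n paravector set" where
  "slice_plane I = range (slice_map I)"

definition circularization :: "complex set \<Rightarrow> 'n::{finite,linorder} paravector set" where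
  "circularization E = {slice_map I z | I z. I \<in> imag_units \<and> z \<in> E}"

definition circular :: "'n::{finite,linorder} paravector set \<Rightarrow> bool" where
  "circular \<Omega> \<longleftrightarrow> (\<exists>E. \<Omega> = circularization E)"

definition stem_domain :: "'n::{finite,linorder} paravector set \<Rightarrow> complex set" where
  "stem_domain \<Omega> = {z. \<forall>I\<in>imag_units. slice_map I z \<in> \<Omega>}"

definition nonreal_part :: "'n::finite paravector set \<Rightarrow> 'n paravector set" where
  "nonreal_part \<Omega> = \<Omega> - real_paravectors"

section \<open>Classes of functions\<close>

text \<open>
  A function on an open set is represented by a total function, whose values off that set are
  irrelevant.
\<close>

definition C0 :: "'a::topological_space set \<Rightarrow> ('a \<Rightarrow> 'b::topological_space) set" where
  "C0 U = {f. continuous_on U f}"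

definition C1 :: "'a::real_normed_vector set \<Rightarrow> ('a \<Rightarrow> 'b::real_normed_vector) set" where
  "C1 U = {f. \<exists>f' :: 'a \<Rightarrow> 'a \<Rightarrow>\<^sub>L 'b.
     (\<forall>x\<in>U. (f has_derivative blinfun_apply (f' x)) (at x)) \<and> continuous_on U f'}"

definition C0_slice :: "'n::{finite,linorder} paravector set \<Rightarrow> ('n paravector \<Rightarrow> 'n clifford) set"
  where "C0_slice \<Omega> = {f. \<forall>I\<in>imag_units. continuous_on (\<Omega> \<inter> slice_plane I) f}"

definition C1_slice :: "'n::{finite,linorder} paravector set \<Rightarrow> ('n paravector \<Rightarrow> 'n clifford) set"
  where "C1_slice \<Omega> = {f. \<forall>I\<in>imag_units. f \<circ> slice_map I \<in> C1 (stem_domain \<Omega>)}"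

section \<open>Differential operators\<close>

definition partial_deriv ::
    "'a::real_normed_vector \<Rightarrow> ('a \<Rightarrow> 'b::real_normed_vector) \<Rightarrow> 'a \<Rightarrow> 'b" where
  "partial_deriv v f x = vector_derivative (\<lambda>t. f (x + t *\<^sub>R v)) (at 0)"

abbreviation e0 :: "'n::finite paravector" where
  "e0 \<equiv> (1, 0)"

abbreviation e_axis :: "'n::finite \<Rightarrow> 'n paravector" where
  "e_axis h \<equiv> (0, axis h 1)"

text \<open>
  For \<open>I \<in> imag_units\<close> the map \<open>slice_map I\<close> is injective on the whole complex plane, so
  \<open>inv (slice_map I)\<close> agrees on \<open>\<Omega> \<inter> slice_plane I\<close> with the inverse of its restriction
  to \<open>stem_domain \<Omega>\<close>.
\<close>

definition dbar_slice ::
    "'n::{finite,linorder} paravector \<Rightarrow> ('n paravector \<Rightarrow> 'n clifford) \<Rightarrow>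
     'n paravector \<Rightarrow> 'n clifford" where
  "dbar_slice I g x = (let z = inv (slice_map I) x in
     (1 / 2) *\<^sub>R (partial_deriv 1 (g \<circ> slice_map I) z +
                cl I * partial_deriv \<i> (g \<circ> slice_map I) z))"

definition slice_monogenic ::
    "'n::{finite,linorder} paravector set \<Rightarrow> ('n paravector \<Rightarrow> 'n clifford) set" where
  "slice_monogenic \<Omega> =
     {f \<in> C1 \<Omega>. \<forall>I\<in>imag_units. \<forall>x\<in>\<Omega> \<inter> slice_plane I. dbar_slice I f x = 0}"

definition thetabar ::
    "('n::{finite,linorder} paravector \<Rightarrow> 'n clifford) \<Rightarrow> 'n paravector \<Rightarrow> 'n clifford" where
  "thetabar f x = (1 / 2) *\<^sub>R (partial_deriv e0 f x +
     ((1 / (norm (im_part x))\<^sup>2) *\<^sub>R cl (im_part x)) *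
       (\<Sum>h\<in>UNIV. (snd x $ h) *\<^sub>R partial_deriv (e_axis h) f x))"

definition global_op ::
    "('n::{finite,linorder} paravector \<Rightarrow> 'n clifford) \<Rightarrow> 'n paravector \<Rightarrow> 'n clifford" where
  "global_op f x = (norm (im_part x))\<^sup>2 *\<^sub>R partial_deriv e0 f x +
     cl (im_part x) * (\<Sum>h\<in>UNIV. (snd x $ h) *\<^sub>R partial_deriv (e_axis h) f x)"

section \<open>Stem functions and slice functions\<close>

text \<open>
  \<open>F\<^sub>1 + i F\<^sub>2\<close> in the complexified Clifford algebra is represented by the pair \<open>(F\<^sub>1, F\<^sub>2)\<close>.
\<close>

definition stem_function :: "complex set \<Rightarrow> (complex \<Rightarrow> 'n clifford \<times> 'n clifford) \<Rightarrow> bool" where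
  "stem_function D F \<longleftrightarrow> (\<forall>z\<in>D. fst (F (cnj z)) = fst (F z) \<and> snd (F (cnj z)) = - snd (F z))"

text \<open>The description below is single-valued when \<open>F\<close> is a stem function on \<open>D\<close>.\<close>

definition induced_slice ::
    "complex set \<Rightarrow> (complex \<Rightarrow> 'n clifford \<times> 'n clifford) \<Rightarrow>
     'n::{finite,linorder} paravector \<Rightarrow> 'n clifford" where
  "induced_slice D F x =
     (THE y. \<exists>z\<in>D. \<exists>I\<in>imag_units. x = slice_map I z \<and> y = fst (F z) + cl I * snd (F z))"

definition C1_stem_of ::
    "'n::{finite,linorder} paravector set \<Rightarrow> ('n paravector \<Rightarrow> 'n clifford) \<Rightarrow>
     (complex \<Rightarrow> 'n clifford \<times> 'n clifford) \<Rightarrow> bool" where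
  "C1_stem_of \<Omega> f F \<longleftrightarrow>
     stem_function (stem_domain \<Omega>) F \<and>
     fst \<circ> F \<in> C1 (stem_domain \<Omega>) \<and> snd \<circ> F \<in> C1 (stem_domain \<Omega>) \<and>
     (\<forall>x\<in>\<Omega>. f x = induced_slice (stem_domain \<Omega>) F x)"

definition C1_slice_functions ::
    "'n::{finite,linorder} paravector set \<Rightarrow> ('n paravector \<Rightarrow> 'n clifford) set" where
  "C1_slice_functions \<Omega> = {f. \<exists>F. C1_stem_of \<Omega> f F}"

definition dbar_stem ::
    "(complex \<Rightarrow> 'n::finite clifford \<times> 'n clifford) \<Rightarrow> complex \<Rightarrow> 'n clifford \<times> 'n clifford" where
  "dbar_stem F z =
     ((1 / 2) *\<^sub>R (partial_deriv 1 (fst \<circ> F) z - partial_deriv \<i> (snd \<circ> F) z),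
      (1 / 2) *\<^sub>R (partial_deriv \<i> (fst \<circ> F) z + partial_deriv 1 (snd \<circ> F) z))"

text \<open>
  The stem function of \<open>f\<close> is determined by \<open>f\<close> on the open set \<open>stem_domain \<Omega>\<close>, so the choice
  of \<open>F\<close> does not affect the value on \<open>\<Omega>\<close>.
\<close>

definition slice_deriv_conj ::
    "'n::{finite,linorder} paravector set \<Rightarrow> ('n paravector \<Rightarrow> 'n clifford) \<Rightarrow>
     'n paravector \<Rightarrow> 'n clifford" where
  "slice_deriv_conj \<Omega> f =
     induced_slice (stem_domain \<Omega>) (dbar_stem (SOME F. C1_stem_of \<Omega> f F))"

end

theory Submission
  imports Defs "HOL-Complex_Analysis.Complex_Analysis"
begin

text \<open>
  The seven conditions say that \<open>f\<close> is holomorphic on each of the planes spanned by \<open>1\<close> and an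
  imaginary unit \<open>I\<close>, for the complex structure given by left multiplication by \<open>I\<close>. They differ in
  the regularity that they demand of \<open>f\<close> and in how they write the Cauchy-Riemann equation.

  The differential operators differ only superficially: off the real axis, \<open>thetabar\<close> is the
  Cauchy-Riemann operator of the plane through the point in question (\<open>thetabar_slice_map\<close>), and
  \<open>global_op\<close> is \<open>2 |Im x|\<^sup>2\<close> times \<open>thetabar\<close> and vanishes at real points. The obvious implications
  are therefore (a) to (c) to (b) to (b'), the equivalence of (c) and (d), and (a) to (a'). The
  circle is closed by three facts, in which regularity is gained.

  \<^item> From (b') to (a'): the slices are holomorphic off the real line and continuous on it, and a line
    is removable for continuous functions (\<open>left_holomorphic_across_reals\<close>).

  \<^item> From (a') to (e): one slice, split into its even and odd part under conjugation, gives a stem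
    function. On any other plane, the function that it induces and \<open>f\<close> itself are both
    holomorphic and coincide at the real points of \<open>\<Omega>\<close>. As the stem domain is connected, they are
    equal by the identity theorem (\<open>left_holomorphic_slices_imp_C1_slice_function\<close>).

  \<^item> From (e) to (a): a slice function with a \<open>C\<^sup>1\<close> stem function is \<open>C\<^sup>1\<close> in all real variables
    (\<open>C1_slice_functions_subset_C1\<close>). This needs an argument at the real points only, where
    \<open>Im x / |Im x|\<close> is discontinuous and the parity of the stem function compensates for it
    (\<open>C1_axially_symmetric\<close>).

  Complex analysis enters through the functionals \<open>left_coord\<close>, which turn Clifford valued functions
  that are holomorphic for a left complex structure into complex valued holomorphic functions.
\<close>

section \<open>Continuously differentiable functions\<close>

lemma partial_deriv_eq:
  assumes "(f has_derivative f') (at x)"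
  shows "partial_deriv v f x = f' v"
proof -
  have "((\<lambda>t. f (x + t *\<^sub>R v)) has_derivative (\<lambda>t. f' (t *\<^sub>R v))) (at 0)"
    by (rule has_derivative_compose[of "\<lambda>t. x + t *\<^sub>R v", where g = f])
      (use assms in \<open>auto intro!: derivative_eq_intros\<close>)
  then have "((\<lambda>t. f (x + t *\<^sub>R v)) has_vector_derivative f' v) (at 0)"
    using has_derivative_bounded_linear[OF assms]
    by (simp add: has_vector_derivative_def linear_simps)
  then show ?thesis
    unfolding partial_deriv_def by (rule vector_derivative_at)
qed

text \<open>
  Continuity of the derivative needs to be checked one direction at a time only, because the
  domain is finite dimensional.
\<close>

lemma C1I:
  fixes f :: "'a::euclidean_space \<Rightarrow> 'b::real_normed_vector"
  assumes "\<And>x. x \<in> U \<Longrightarrow> (f has_derivative f' x) (at x)"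
    and "\<And>v. continuous_on U (\<lambda>x. f' x v)"
  shows "f \<in> C1 U"
  unfolding C1_def
proof (intro CollectI exI conjI ballI)
  have app: "blinfun_apply (Blinfun (f' x)) = f' x" if "x \<in> U" for x
    using assms(1)[OF that] by (intro bounded_linear_Blinfun_apply has_derivative_bounded_linear)
  show "(f has_derivative blinfun_apply (Blinfun (f' x))) (at x)" if "x \<in> U" for x
    using assms(1) app that by simp
  show "continuous_on U (\<lambda>x. Blinfun (f' x))"
    by (rule continuous_on_blinfun_componentwise)
      (simp add: app assms(2) cong: continuous_on_cong)
qed

lemma C1E:
  assumes "f \<in> C1 U"
  obtains f' :: "'a::real_normed_vector \<Rightarrow> 'a \<Rightarrow>\<^sub>L 'b::real_normed_vector"
  where "\<And>x. x \<in> U \<Longrightarrow> (f has_derivative blinfun_apply (f' x)) (at x)" "continuous_on U f'"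
  using assms unfolding C1_def by blast

lemma C1_has_derivative:
  assumes "f \<in> C1 U" "x \<in> U"
  shows "\<exists>f'. (f has_derivative f') (at x)"
  using assms unfolding C1_def by blast

lemma C1_subset: "f \<in> C1 U \<Longrightarrow> V \<subseteq> U \<Longrightarrow> f \<in> C1 V"
  unfolding C1_def using continuous_on_subset by blast

lemma C1_imp_continuous_on: "f \<in> C1 U \<Longrightarrow> continuous_on U f"
  by (metis C1E continuous_at_imp_continuous_on has_derivative_continuous)

lemma C1_cong:
  assumes "f \<in> C1 U" "open U" "\<And>x. x \<in> U \<Longrightarrow> f x = g x"
  shows "g \<in> C1 U"
proof -
  obtain f' where f': "\<And>x. x \<in> U \<Longrightarrow> (f has_derivative blinfun_apply (f' x)) (at x)"
    and cf: "continuous_on U f'" using assms(1) by (rule C1E) blast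
  have "(g has_derivative blinfun_apply (f' x)) (at x)" if "x \<in> U" for x
    using has_derivative_transform_within_open[OF f'[OF that] assms(2) that assms(3)] .
  then show ?thesis
    unfolding C1_def using cf by (intro CollectI exI conjI ballI)
qed

lemma C1_bounded_linear:
  assumes "bounded_linear L" shows "L \<in> C1 U"
  unfolding C1_def
  by (intro CollectI exI[of _ "\<lambda>_. Blinfun L"])
    (use assms in \<open>auto simp: bounded_linear_Blinfun_apply bounded_linear_imp_has_derivative\<close>)

lemma C1_compose:
  assumes f: "f \<in> C1 V" and g: "g \<in> C1 U" and sub: "g ` U \<subseteq> V"
  shows "f \<circ> g \<in> C1 U"
proof -
  obtain f' where f': "\<And>x. x \<in> V \<Longrightarrow> (f has_derivative blinfun_apply (f' x)) (at x)"
    and cf: "continuous_on V f'" using f by (rule C1E) blast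
  obtain g' where g': "\<And>x. x \<in> U \<Longrightarrow> (g has_derivative blinfun_apply (g' x)) (at x)"
    and cg: "continuous_on U g'" using g by (rule C1E) blast
  have "continuous_on U (\<lambda>x. f' (g x))"
    using continuous_on_compose2[OF cf C1_imp_continuous_on[OF g]] sub by blast
  then have "continuous_on U (\<lambda>x. f' (g x) o\<^sub>L g' x)"
    using cg by (rule bounded_bilinear.continuous_on[OF bounded_bilinear_blinfun_compose])
  moreover have "(f \<circ> g has_derivative blinfun_apply (f' (g x) o\<^sub>L g' x)) (at x)" if "x \<in> U" for x
    using diff_chain_at[OF g'[OF that] f'] sub that
    by (auto simp: comp_def blinfun_compose.rep_eq)
  ultimately show ?thesis
    unfolding C1_def by (intro CollectI exI conjI ballI)
qed

lemma C1_add: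
  assumes "f \<in> C1 U" "g \<in> C1 U" shows "(\<lambda>x. f x + g x) \<in> C1 U"
proof -
  obtain f' where f': "\<And>x. x \<in> U \<Longrightarrow> (f has_derivative blinfun_apply (f' x)) (at x)"
    and cf: "continuous_on U f'" using assms(1) by (rule C1E) blast
  obtain g' where g': "\<And>x. x \<in> U \<Longrightarrow> (g has_derivative blinfun_apply (g' x)) (at x)"
    and cg: "continuous_on U g'" using assms(2) by (rule C1E) blast
  have "((\<lambda>x. f x + g x) has_derivative blinfun_apply (f' x + g' x)) (at x)" if "x \<in> U" for x
    using has_derivative_add[OF f'[OF that] g'[OF that]] by (simp add: plus_blinfun.rep_eq)
  moreover have "continuous_on U (\<lambda>x. f' x + g' x)"
    by (intro continuous_intros cf cg)
  ultimately show ?thesis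
    unfolding C1_def by (intro CollectI exI conjI ballI)
qed

section \<open>Clifford multiplication and imaginary units\<close>

lemma bounded_bilinear_clifford_mult:
  "bounded_bilinear ((*) :: 'n::{finite,linorder} clifford \<Rightarrow> _)"
  by (subst bilinear_conv_bounded_bilinear[symmetric])
    (auto simp: bilinear_def distrib_left distrib_right intro!: linearI)

lemma bounded_linear_cl: "bounded_linear (cl :: 'n::{finite,linorder} paravector \<Rightarrow> _)"
  by (subst linear_conv_bounded_linear[symmetric])
    (auto simp: cl_def of_real_def algebra_simps sum.distrib scaleR_sum_right intro!: linearI)

lemma bounded_linear_blade_coeff: "bounded_linear (\<lambda>x::'n::finite clifford. blade_coeff x A)"
  by (subst linear_conv_bounded_linear[symmetric]) (auto intro!: linearI)

lemma clifford_expansion: "x = (\<Sum>A\<in>UNIV. blade_coeff x A *\<^sub>R blade A)"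
  for x :: "'n::finite clifford"
proof -
  have coeff_sum: "blade_coeff (sum g S) B = (\<Sum>A\<in>S. blade_coeff (g A) B)"
    for g :: "'n set \<Rightarrow> 'n clifford" and S B
    by (induction S rule: infinite_finite_induct) auto
  show ?thesis
    by (simp add: clifford_eq_iff coeff_sum if_distrib cong: if_cong)
qed

text \<open>
  The mixed terms \<open>v\<^sub>j v\<^sub>k e\<^sub>j e\<^sub>k\<close> and \<open>v\<^sub>k v\<^sub>j e\<^sub>k e\<^sub>j\<close> cancel by anticommutation, so adding
  the double sum to its transpose leaves only the diagonal.
\<close>

lemma cl_imaginary_square:
  fixes v :: "real ^ 'n::{finite,linorder}"
  shows "cl (0, v) * cl (0, v) = - of_real ((norm v)\<^sup>2)"
proof -
  let ?e = "generator :: 'n \<Rightarrow> 'n clifford"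
  let ?t = "\<lambda>j k. (v $ j * v $ k) *\<^sub>R (?e j * ?e k)"
  have prod: "cl (0, v) * cl (0, v) = (\<Sum>j\<in>UNIV. \<Sum>k\<in>UNIV. ?t j k)"
    by (simp add: cl_def sum_product ac_simps)
  define S where "S = (\<Sum>j\<in>UNIV. \<Sum>k\<in>UNIV. ?t j k)"
  have swap: "S = (\<Sum>j\<in>UNIV. \<Sum>k\<in>UNIV. ?t k j)"
    unfolding S_def by (rule sum.swap)
  have "S + S = (\<Sum>j\<in>UNIV. \<Sum>k\<in>UNIV. ?t j k + ?t k j)"
    unfolding sum.distrib S_def[symmetric] swap[symmetric] ..
  also have "\<dots> = (\<Sum>j\<in>UNIV. \<Sum>k\<in>UNIV. if j = k then (- 2 * (v $ j)\<^sup>2) *\<^sub>R 1 else 0)"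
  proof (intro sum.cong refl)
    fix j k
    show "?t j k + ?t k j = (if j = k then (- 2 * (v $ j)\<^sup>2) *\<^sub>R 1 else 0)"
    proof (cases "j = k")
      case True
      then show ?thesis
        by (simp add: generator_sq power2_eq_square scaleR_2[symmetric])
    next
      case False
      then show ?thesis
        by (simp add: generator_anticommute[OF False] mult.commute[of "v $ j"])
    qed
  qed
  also have "\<dots> = (\<Sum>j\<in>UNIV. - 2 * (v $ j)\<^sup>2) *\<^sub>R 1"
    unfolding scaleR_sum_left by simp
  also have "(\<Sum>j\<in>UNIV. - 2 * (v $ j)\<^sup>2) = - 2 * (norm v)\<^sup>2"
    unfolding sum_distrib_left[symmetric]
    by (simp add: power2_norm_eq_inner inner_vec_def) (simp add: power2_eq_square)
  finally have "2 *\<^sub>R S = 2 *\<^sub>R (- of_real ((norm v)\<^sup>2))"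
    by (simp add: scaleR_2[symmetric] of_real_def)
  then have "S = - of_real ((norm v)\<^sup>2)"
    unfolding scaleR_cancel_left by simp
  then show ?thesis
    unfolding prod S_def[symmetric] .
qed

text \<open>
  With \<open>x = a + v\<close> the square is \<open>(a\<^sup>2 - |v|\<^sup>2) + 2 a v\<close>. It equals \<open>-1\<close> only if \<open>a v = 0\<close>, and
  \<open>v = 0\<close> is excluded because real squares are nonnegative.
\<close>

lemma imag_units_iff: "(I :: 'n::{finite,linorder} paravector) \<in> imag_units \<longleftrightarrow>
    fst I = 0 \<and> norm (snd I) = 1"
proof -
  obtain a v where I: "I = (a, v)" by force
  have split: "cl (a, v) = a *\<^sub>R 1 + cl (0, v)"
    by (simp add: cl_def of_real_def)
  have square: "cl I * cl I = (a\<^sup>2 - (norm v)\<^sup>2) *\<^sub>R 1 + (2 * a) *\<^sub>R cl (0, v)"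
    unfolding I split distrib_left distrib_right cl_imaginary_square
    by (simp add: of_real_def power2_eq_square algebra_simps scaleR_2[symmetric])
  show ?thesis
  proof
    assume "I \<in> imag_units"
    then have eq: "(a\<^sup>2 - (norm v)\<^sup>2) *\<^sub>R 1 + (2 * a) *\<^sub>R cl (0, v) = - 1"
      by (simp add: imag_units_def square)
    have sum_coeff: "blade_coeff (\<Sum>j\<in>UNIV. v $ j *\<^sub>R generator j) A =
        (\<Sum>j\<in>UNIV. v $ j * (if A = {j} then 1 else 0))" for A
      using bounded_linear.linear[OF bounded_linear_blade_coeff[of A]]
      by (subst linear_sum[of "\<lambda>x. blade_coeff x A"]) auto
    have "blade_coeff (cl (0, v)) {} = 0" "blade_coeff (cl (0, v)) {j} = v $ j" for j
      by (simp_all add: cl_def sum_coeff if_distrib cong: if_cong)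
    then have 1: "a\<^sup>2 - (norm v)\<^sup>2 = - 1" and 2: "2 * a * v $ j = 0" for j
      using arg_cong[OF eq, of "\<lambda>x. blade_coeff x {}"]
        arg_cong[OF eq, of "\<lambda>x. blade_coeff x {j}"]
      by (simp_all add: one_clifford_def)
    have "a = 0"
    proof (rule ccontr)
      assume "a \<noteq> 0"
      then have "v = 0" using 2 by (simp add: vec_eq_iff)
      then show False using 1 by (simp add: power2_eq_square) (smt (verit) zero_le_square)
    qed
    then show "fst I = 0 \<and> norm (snd I) = 1"
      using 1 by (simp add: I power2_eq_1_iff) (smt (verit) norm_ge_zero)
  qed (use square in \<open>auto simp: imag_units_def I\<close>)
qed

lemma cl_imag_unit_square: "I \<in> imag_units \<Longrightarrow> cl I * cl I = - 1"
  by (simp add: imag_units_def)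

lemma imag_unit_cancel: "I \<in> imag_units \<Longrightarrow> cl I * (cl I * y) = - y"
  by (simp add: cl_imag_unit_square mult.assoc[symmetric])

lemma uminus_imag_units: "I \<in> imag_units \<Longrightarrow> - I \<in> imag_units"
  by (simp add: imag_units_iff)

lemma imag_units_nonempty: "\<exists>I. I \<in> imag_units"
  by (rule exI[of _ "(0, axis undefined 1)"]) (simp add: imag_units_iff)

section \<open>Functions holomorphic for left multiplication by an imaginary unit\<close>

text \<open>
  Left multiplication by \<open>u\<close> with \<open>u\<^sup>2 = -1\<close> makes the Clifford algebra a complex vector space.
  For a real linear functional \<open>l\<close> the map \<open>y \<mapsto> l(y) - \<i> l(u y)\<close> is complex linear for this
  structure; taking for \<open>l\<close> the blade coefficients gives enough such functionals to separate
  points, so that results on complex valued holomorphic functions transfer to Clifford valued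
  ones.
\<close>

definition left_coord :: "'n::{finite,linorder} clifford \<Rightarrow> 'n set \<Rightarrow> 'n clifford \<Rightarrow> complex" where
  "left_coord u A y = Complex (blade_coeff y A) (- blade_coeff (u * y) A)"

definition left_holomorphic ::
    "'n::{finite,linorder} clifford \<Rightarrow> complex set \<Rightarrow> (complex \<Rightarrow> 'n clifford) \<Rightarrow> bool" where
  "left_holomorphic u D g \<longleftrightarrow> (\<forall>A. (\<lambda>z. left_coord u A (g z)) holomorphic_on D)"

lemma bounded_linear_left_coord: "bounded_linear (left_coord u A)"
  by (subst linear_conv_bounded_linear[symmetric])
    (auto simp: left_coord_def complex_eq_iff distrib_left intro!: linearI)

lemma left_coord_simps:
  "left_coord u A 0 = 0"
  "left_coord u A (x + y) = left_coord u A x + left_coord u A y"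
  "left_coord u A (x - y) = left_coord u A x - left_coord u A y"
  "left_coord u A (r *\<^sub>R x) = of_real r * left_coord u A x"
  by (simp_all add: left_coord_def complex_eq_iff algebra_simps)

lemma left_coord_mult_unit:
  assumes "u * u = - 1"
  shows "left_coord u A (u * y) = \<i> * left_coord u A y"
  using assms by (simp add: left_coord_def complex_eq_iff mult.assoc[symmetric])

lemma left_coord_eq_zero: "(\<And>A. left_coord u A y = 0) \<Longrightarrow> y = 0"
  by (simp add: left_coord_def clifford_eq_iff complex_eq_iff)

lemma left_holomorphic_imp_C1:
  assumes "open D" "left_holomorphic u D g"
  shows "g \<in> C1 D"
proof (rule C1I)
  let ?f' = "\<lambda>z h. \<Sum>A\<in>UNIV. Re (deriv (\<lambda>z. left_coord u A (g z)) z * h) *\<^sub>R blade A"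
  have expand: "(\<Sum>A\<in>UNIV. Re (left_coord u A (g z)) *\<^sub>R blade A) = g z" for z
    by (simp add: left_coord_def clifford_expansion[symmetric])
  show "(g has_derivative ?f' z) (at z)" if "z \<in> D" for z
  proof -
    have "((\<lambda>z. Re (left_coord u A (g z)) *\<^sub>R (blade A :: 'a clifford)) has_derivative
        (\<lambda>h. Re (deriv (\<lambda>z. left_coord u A (g z)) z * h) *\<^sub>R blade A)) (at z)" for A :: "'a set"
    proof -
      have "((\<lambda>z. left_coord u A (g z)) has_field_derivative deriv (\<lambda>z. left_coord u A (g z)) z)
          (at z)"
        using assms that unfolding left_holomorphic_def by (blast intro: holomorphic_derivI)
      then show ?thesis
        unfolding has_field_derivative_def
        by (intro has_derivative_scaleR_left bounded_linear.has_derivative[OF bounded_linear_Re])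
    qed
    then have "((\<lambda>z. \<Sum>A\<in>UNIV. Re (left_coord u A (g z)) *\<^sub>R blade A) has_derivative ?f' z) (at z)"
      by (rule has_derivative_sum)
    then show ?thesis
      unfolding expand .
  qed
  show "continuous_on D (\<lambda>z. ?f' z h)" for h
    using assms unfolding left_holomorphic_def
    by (intro continuous_intros holomorphic_on_imp_continuous_on holomorphic_deriv) auto
qed

text \<open>
  If \<open>g'\<close> is the real derivative of \<open>g\<close>, the equation \<open>g'(1) + u g'(\<i>) = 0\<close> says
  \<open>g'(\<i>) = u g'(1)\<close>, that is, that \<open>g'\<close> is complex linear from the complex plane to the Clifford
  algebra with the complex structure \<open>u\<close>. Read in the coordinates \<open>left_coord u A\<close>, this is
  complex differentiability.
\<close>

lemma left_holomorphic_iff: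
  assumes u: "u * u = - 1" and "open D"
  shows "left_holomorphic u D g \<longleftrightarrow>
    g \<in> C1 D \<and> (\<forall>z\<in>D. partial_deriv 1 g z + u * partial_deriv \<i> g z = 0)"
proof (intro iffI conjI ballI)
  assume hol: "left_holomorphic u D g"
  show C1: "g \<in> C1 D"
    using left_holomorphic_imp_C1[OF \<open>open D\<close> hol] .
  fix z assume "z \<in> D"
  obtain g' where g': "(g has_derivative g') (at z)"
    using C1_has_derivative[OF C1 \<open>z \<in> D\<close>] by blast
  have "left_coord u A (g' 1 + u * g' \<i>) = 0" for A
  proof -
    obtain d where "((\<lambda>z. left_coord u A (g z)) has_field_derivative d) (at z)"
      using hol \<open>z \<in> D\<close> unfolding left_holomorphic_def holomorphic_on_open[OF \<open>open D\<close>] by blast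
    then have "((\<lambda>z. left_coord u A (g z)) has_derivative (\<lambda>h. d * h)) (at z)"
      by (simp add: has_field_derivative_def)
    moreover have "((\<lambda>z. left_coord u A (g z)) has_derivative (\<lambda>h. left_coord u A (g' h))) (at z)"
      by (rule bounded_linear.has_derivative[OF bounded_linear_left_coord g'])
    ultimately have "(\<lambda>h. d * h) = (\<lambda>h. left_coord u A (g' h))"
      by (rule has_derivative_unique)
    then have "left_coord u A (g' h) = d * h" for h
      by metis
    then show ?thesis
      by (simp add: left_coord_simps left_coord_mult_unit[OF u] complex_eq_iff)
  qed
  then show "partial_deriv 1 g z + u * partial_deriv \<i> g z = 0"
    unfolding partial_deriv_eq[OF g'] by (rule left_coord_eq_zero)
next
  assume *: "g \<in> C1 D \<and> (\<forall>z\<in>D. partial_deriv 1 g z + u * partial_deriv \<i> g z = 0)"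
  show "left_holomorphic u D g"
    unfolding left_holomorphic_def
  proof
    fix A
    show "(\<lambda>z. left_coord u A (g z)) holomorphic_on D"
      unfolding holomorphic_on_open[OF \<open>open D\<close>]
    proof (intro ballI allI impI)
      fix z assume "z \<in> D"
      obtain g' where g': "(g has_derivative g') (at z)"
        using C1_has_derivative[OF conjunct1[OF *] \<open>z \<in> D\<close>] by blast
      have "g' 1 = - (u * g' \<i>)"
        using bspec[OF conjunct2[OF *] \<open>z \<in> D\<close>]
        by (simp add: partial_deriv_eq[OF g'] eq_neg_iff_add_eq_0)
      then have *: "g' \<i> = u * g' 1"
        using u by (simp add: mult.assoc[symmetric])
      have lin: "left_coord u A (g' h) = left_coord u A (g' 1) * h" for h
      proof -
        have h: "Re h *\<^sub>R 1 + Im h *\<^sub>R \<i> = h"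
          by (simp add: complex_eq_iff)
        have "g' (Re h *\<^sub>R 1 + Im h *\<^sub>R \<i>) = Re h *\<^sub>R g' 1 + Im h *\<^sub>R (u * g' 1)"
          by (simp only: linear_simps[OF has_derivative_bounded_linear[OF g']] *)
        then have "g' h = Re h *\<^sub>R g' 1 + Im h *\<^sub>R (u * g' 1)"
          unfolding h .
        then have "left_coord u A (g' h) = (Re h + \<i> * Im h) * left_coord u A (g' 1)"
          by (simp add: left_coord_simps left_coord_mult_unit[OF u] algebra_simps)
        then show ?thesis
          by (simp add: complex_eq[symmetric] mult.commute)
      qed
      have "((\<lambda>z. left_coord u A (g z)) has_derivative (\<lambda>h. left_coord u A (g' h))) (at z)"
        by (rule bounded_linear.has_derivative[OF bounded_linear_left_coord g'])
      also have "(\<lambda>h. left_coord u A (g' h)) = (*) (left_coord u A (g' 1))"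
        using lin by (rule ext)
      finally have "((\<lambda>z. left_coord u A (g z)) has_field_derivative left_coord u A (g' 1)) (at z)"
        unfolding has_field_derivative_def .
      then show "\<exists>d. ((\<lambda>z. left_coord u A (g z)) has_field_derivative d) (at z)" ..
    qed
  qed
qed

text \<open>
  The real line is removable for functions continuous across it (a consequence of Morera's
  theorem). This is what allows condition (b'), which says nothing about differentiability at the
  real points, to imply the others.
\<close>

lemma left_holomorphic_across_reals:
  assumes "open D" "continuous_on D g" "left_holomorphic u (D - \<real>) g"
  shows "left_holomorphic u D g"
  unfolding left_holomorphic_def
proof
  fix A
  have hol: "(\<lambda>z. left_coord u A (g z)) holomorphic_on (D - \<real>)"
    using assms(3) unfolding left_holomorphic_def by blast
  show "(\<lambda>z. left_coord u A (g z)) holomorphic_on D"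
  proof (rule holomorphic_on_paste_across_line[of _ \<i> _ 0])
    show "continuous_on D (\<lambda>z. left_coord u A (g z))"
      using assms(2) by (intro bounded_linear.continuous_on[OF bounded_linear_left_coord])
  qed (use assms(1) hol in \<open>auto simp: complex_is_Real_iff elim: holomorphic_on_subset\<close>)
qed

text \<open>
  The coordinates of \<open>f - g\<close> are complex holomorphic and vanish on the real points of \<open>D\<close>, which
  accumulate in the open set \<open>D\<close>.
\<close>

lemma left_holomorphic_identity:
  assumes f: "left_holomorphic u D f" and g: "left_holomorphic u D g"
    and D: "open D" "connected D" "D \<inter> \<real> \<noteq> {}"
    and eq: "\<And>z. z \<in> D \<inter> \<real> \<Longrightarrow> f z = g z"
    and "w \<in> D"
  shows "f w = g w"
proof -
  obtain c where c: "c \<in> D" "c \<in> \<real>"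
    using D(3) by blast
  have "c islimpt (D \<inter> \<real>)"
  proof (rule islimptI)
    fix T assume "c \<in> T" "open T"
    then obtain e where e: "e > 0" "ball c e \<subseteq> D \<inter> T"
      using c D(1) by (meson IntI openE open_Int)
    then have "c + of_real (e / 2) \<in> D \<inter> T"
      by (auto simp: dist_norm subset_iff)
    moreover have "c + of_real (e / 2) \<in> \<real>"
      using c(2) by (intro Reals_add) simp_all
    ultimately show "\<exists>y\<in>D \<inter> \<real>. y \<in> T \<and> y \<noteq> c"
      using e(1) by (intro bexI[of _ "c + of_real (e / 2)"]) auto
  qed
  have "left_coord u A (f w - g w) = 0" for A
  proof (rule analytic_continuation[where
        f = "\<lambda>z. left_coord u A (f z - g z)" and U = "D \<inter> \<real>" and \<xi> = c])
    show "(\<lambda>z. left_coord u A (f z - g z)) holomorphic_on D"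
      using f g unfolding left_coord_simps left_holomorphic_def
      by (intro holomorphic_on_diff) auto
    show "left_coord u A (f z - g z) = 0" if "z \<in> D \<inter> \<real>" for z
      using eq[OF that] by (simp add: left_coord_simps)
  qed (use D c \<open>w \<in> D\<close> \<open>c islimpt (D \<inter> \<real>)\<close> in auto)
  then show ?thesis
    using left_coord_eq_zero[of u "f w - g w"] by simp
qed

section \<open>The stem function attached to one slice\<close>

text \<open>
  The even and odd parts of \<open>g\<close> under conjugation. If \<open>g\<close> is the slice \<open>F\<^sub>1 + u F\<^sub>2\<close> of a slice
  function, the even part is \<open>F\<^sub>1\<close> and the odd part is \<open>u F\<^sub>2\<close>; multiplying the latter by \<open>-u\<close>
  recovers \<open>F\<^sub>2\<close>.
\<close>

definition stem_of_slice ::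
    "'n::{finite,linorder} clifford \<Rightarrow> (complex \<Rightarrow> 'n clifford) \<Rightarrow>
     complex \<Rightarrow> 'n clifford \<times> 'n clifford" where
  "stem_of_slice u g z =
     ((1 / 2) *\<^sub>R (g z + g (cnj z)), (1 / 2) *\<^sub>R (u * (g (cnj z) - g z)))"

lemma stem_function_stem_of_slice: "stem_function D (stem_of_slice u g)"
  by (simp add: stem_function_def stem_of_slice_def algebra_simps)

lemma stem_of_slice_C1:
  assumes g: "g \<in> C1 D" and cnj: "\<And>z. z \<in> D \<Longrightarrow> cnj z \<in> D"
  shows "fst \<circ> stem_of_slice u g \<in> C1 D" "snd \<circ> stem_of_slice u g \<in> C1 D"
proof -
  have gc: "g \<circ> cnj \<in> C1 D"
    using cnj by (intro C1_compose[OF g] C1_bounded_linear bounded_linear_cnj) auto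
  have lin: "(\<lambda>z. L (h z)) \<in> C1 D" if "bounded_linear L" "h \<in> C1 D"
    for L :: "'a clifford \<Rightarrow> 'a clifford" and h
    using C1_compose[OF C1_bounded_linear[OF that(1), of UNIV] that(2)] by (simp add: comp_def)
  have u: "bounded_linear (\<lambda>y. (1 / 2) *\<^sub>R (u * y))"
    by (intro bounded_linear_const_scaleR
        bounded_bilinear.bounded_linear_right[OF bounded_bilinear_clifford_mult])
  have "(\<lambda>z. (1 / 2) *\<^sub>R (g z + (g \<circ> cnj) z)) \<in> C1 D"
    by (intro lin[OF bounded_linear_scaleR_right] C1_add g gc)
  then show "fst \<circ> stem_of_slice u g \<in> C1 D"
    by (simp add: stem_of_slice_def comp_def)
  have "(\<lambda>z. (1 / 2) *\<^sub>R (u * ((g \<circ> cnj) z + - g z))) \<in> C1 D"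
    by (intro lin[OF u] C1_add gc lin[OF bounded_linear_minus[OF bounded_linear_ident]] g)
  then show "snd \<circ> stem_of_slice u g \<in> C1 D"
    by (simp add: stem_of_slice_def comp_def)
qed

text \<open>
  The function in question is \<open>\<onehalf> ((1 - w u) g(z) + (1 + w u) g(cnj z))\<close>. Since
  \<open>(1 - w u) u = w (1 - w u)\<close> and \<open>(1 + w u) u = - w (1 + w u)\<close>, the first coefficient carries
  the complex structure \<open>u\<close> to \<open>w\<close>, and the second one carries it to \<open>-w\<close>, which the conjugation
  turns back to \<open>w\<close>.
\<close>

lemma left_holomorphic_stem_of_slice:
  assumes hol: "left_holomorphic u D g" and u: "u * u = - 1" and w: "w * w = - 1"
    and D: "open D" and cnj: "\<And>z. z \<in> D \<Longrightarrow> cnj z \<in> D"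
  shows "left_holomorphic w D (\<lambda>z. fst (stem_of_slice u g z) + w * snd (stem_of_slice u g z))"
    (is "left_holomorphic w D ?h")
  unfolding left_holomorphic_iff[OF w D]
proof (intro conjI ballI)
  have g: "g \<in> C1 D" and cr: "\<And>z. z \<in> D \<Longrightarrow> partial_deriv 1 g z + u * partial_deriv \<i> g z = 0"
    using hol unfolding left_holomorphic_iff[OF u D] by auto
  note bw = bounded_bilinear.bounded_linear_right[OF bounded_bilinear_clifford_mult, of w]
  have "(\<lambda>z. w * (snd \<circ> stem_of_slice u g) z) \<in> C1 D"
    using C1_compose[OF C1_bounded_linear[OF bw, of UNIV] stem_of_slice_C1(2)[OF g cnj]]
    by (simp add: comp_def)
  then show "?h \<in> C1 D"
    using C1_add[OF stem_of_slice_C1(1)[OF g cnj]] by simp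
  fix z assume z: "z \<in> D"
  obtain a where a: "(g has_derivative a) (at z)"
    using C1_has_derivative[OF g z] by blast
  obtain b where b: "(g has_derivative b) (at (cnj z))"
    using C1_has_derivative[OF g cnj[OF z]] by blast
  have ai: "a 1 = - (u * a \<i>)" and bi: "b 1 = - (u * b \<i>)"
    using cr[OF z] cr[OF cnj[OF z]]
    by (simp_all add: partial_deriv_eq[OF a] partial_deriv_eq[OF b] eq_neg_iff_add_eq_0)
  have neg: "b (- \<i>) = - b \<i>"
    using has_derivative_bounded_linear[OF b] by (simp add: linear_simps)
  have bc: "((\<lambda>z. g (cnj z)) has_derivative (\<lambda>h. b (cnj h))) (at z)"
    by (rule has_derivative_compose[OF bounded_linear_imp_has_derivative[OF bounded_linear_cnj] b])
  have "(?h has_derivative (\<lambda>h. (1 / 2) *\<^sub>R (a h + b (cnj h)) +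
      w * ((1 / 2) *\<^sub>R (u * (b (cnj h) - a h))))) (at z)"
    unfolding stem_of_slice_def fst_conv snd_conv
    by (intro has_derivative_add has_derivative_scaleR_right has_derivative_diff a bc
        bounded_linear.has_derivative[OF bw]
        bounded_linear.has_derivative[OF bounded_bilinear.bounded_linear_right[OF
            bounded_bilinear_clifford_mult]])
  note d = partial_deriv_eq[OF this]
  have uu: "u * (u * y) = - y" and ww: "w * (w * y) = - y" for y
    by (simp_all add: u w mult.assoc[symmetric])
  show "partial_deriv 1 ?h z + w * partial_deriv \<i> ?h z = 0"
    unfolding d by (simp add: ai bi neg uu ww algebra_simps)
qed

section \<open>Smoothness of axially symmetric functions\<close>

text \<open>
  The point \<open>x\<^sub>0 + \<i> |Im x|\<close> of the closed upper half plane, at which a stem function is to be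
  evaluated. It depends smoothly on \<open>x\<close> except at the real points, where it is merely Lipschitz.
\<close>

definition axial_point :: "real \<times> 'v::real_normed_vector \<Rightarrow> complex" where
  "axial_point x = Complex (fst x) (norm (snd x))"

lemma axial_point_simps [simp]:
  "Re (axial_point x) = fst x" "Im (axial_point x) = norm (snd x)"
  by (simp_all add: axial_point_def)

lemma continuous_on_axial_point: "continuous_on S axial_point"
  unfolding axial_point_def Complex_eq by (intro continuous_intros)

lemma has_derivative_norm_snd:
  fixes x :: "'a::real_normed_vector \<times> 'v::real_inner"
  assumes "snd x \<noteq> 0"
  shows "((\<lambda>x. norm (snd x)) has_derivative (\<lambda>h. sgn (snd x) \<bullet> snd h)) (at x)"
  using has_derivative_compose[OF has_derivative_snd[OF has_derivative_ident]
      has_derivative_norm[OF assms]]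
  by (simp add: inner_commute)

lemma has_derivative_axial_point:
  fixes x :: "real \<times> 'v::real_inner"
  assumes "snd x \<noteq> 0"
  shows "(axial_point has_derivative (\<lambda>h. Complex (fst h) (sgn (snd x) \<bullet> snd h))) (at x)"
  unfolding axial_point_def Complex_eq
  by (intro has_derivative_add has_derivative_mult_right has_derivative_of_real
      has_derivative_fst has_derivative_ident has_derivative_norm_snd assms)

lemma norm_axial_point_diff_real:
  assumes "snd x = 0"
  shows "norm (axial_point y - axial_point x) = norm (y - x)"
  using assms by (simp add: cmod_def norm_prod_def)

text \<open>
  The direction \<open>sgn (Im x)\<close> jumps at the real points but stays bounded, so a factor that
  vanishes there restores continuity.
\<close>

lemma continuous_on_sgn_times_vanishing:
  fixes B :: "'v::real_inner \<Rightarrow> 'b::real_normed_vector \<Rightarrow> 'c::real_normed_vector"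
    and k :: "'p::real_normed_vector \<times> 'v \<Rightarrow> 'b"
  assumes B: "bounded_bilinear B" and k: "continuous_on S k"
    and zero: "\<And>x. x \<in> S \<Longrightarrow> snd x = 0 \<Longrightarrow> k x = 0"
  shows "continuous_on S (\<lambda>x. B (sgn (snd x)) (k x))"
  unfolding continuous_on_def
proof
  fix x assume x: "x \<in> S"
  have kx: "(k \<longlongrightarrow> k x) (at x within S)"
    using k x by (simp add: continuous_on_def)
  show "((\<lambda>x. B (sgn (snd x)) (k x)) \<longlongrightarrow> B (sgn (snd x)) (k x)) (at x within S)"
  proof (cases "snd x = 0")
    case False
    then have "((\<lambda>x. sgn (snd x)) \<longlongrightarrow> sgn (snd x)) (at x within S)"
      by (intro tendsto_sgn tendsto_snd tendsto_ident_at)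
    then show ?thesis
      using kx by (rule bounded_bilinear.tendsto[OF B])
  next
    case True
    obtain K where K: "K > 0" "\<And>a b. norm (B a b) \<le> norm a * norm b * K"
      using bounded_bilinear.pos_bounded[OF B] by blast
    have "norm (B (sgn (snd y)) (k y)) \<le> norm (k y) * K" for y
    proof -
      have "norm (B (sgn (snd y)) (k y)) \<le> norm (sgn (snd y)) * norm (k y) * K"
        by (rule K(2))
      also have "\<dots> \<le> 1 * norm (k y) * K"
        using K(1) by (intro mult_right_mono) (auto simp: norm_sgn)
      finally show ?thesis by simp
    qed
    moreover have "((\<lambda>y. norm (k y) * K) \<longlongrightarrow> 0) (at x within S)"
      using tendsto_mult_right[OF tendsto_norm[OF kx], of K] zero[OF x True] by simp
    ultimately have "((\<lambda>y. B (sgn (snd y)) (k y)) \<longlongrightarrow> 0) (at x within S)"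
      by (rule Lim_null_comparison[OF eventuallyI])
    then show ?thesis
      using True bounded_bilinear.zero_left[OF B] by simp
  qed
qed

text \<open>
  Where \<open>L\<close> vanishes, the product rule asks of the other factor only continuity.
\<close>

lemma has_derivative_bilinear_vanishing:
  assumes B: "bounded_bilinear B" and L: "bounded_linear L" "L x = 0" and g: "isCont g x"
  shows "((\<lambda>y. B (L y) (g y)) has_derivative (\<lambda>h. B (L h) (g x))) (at x)"
  unfolding has_derivative_at_alt
proof (intro conjI allI impI)
  show "bounded_linear (\<lambda>h. B (L h) (g x))"
    by (rule bounded_linear_compose[OF bounded_bilinear.bounded_linear_left[OF B] L(1)])
  fix e :: real assume "e > 0"
  obtain K where K: "K > 0" "\<And>a b. norm (B a b) \<le> norm a * norm b * K"
    using bounded_bilinear.pos_bounded[OF B] by blast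
  obtain M where M: "M > 0" "\<And>h. norm (L h) \<le> norm h * M"
    using bounded_linear.pos_bounded[OF L(1)] by blast
  obtain d where d: "d > 0" "\<And>y. dist y x < d \<Longrightarrow> dist (g y) (g x) < e / (M * K)"
    using g[unfolded continuous_at_eps_delta, rule_format, of "e / (M * K)"] \<open>e > 0\<close> K(1) M(1)
    by auto
  have "norm (B (L y) (g y) - B (L x) (g x) - B (L (y - x)) (g x)) \<le> e * norm (y - x)"
    if "norm (y - x) < d" for y
  proof -
    have Ly: "L (y - x) = L y"
      using linear_diff[OF bounded_linear.linear[OF L(1)], of y x] L(2) by simp
    have "B (L y) (g y) - B (L x) (g x) - B (L (y - x)) (g x) = B (L (y - x)) (g y - g x)"
      unfolding Ly L(2) bounded_bilinear.zero_left[OF B] bounded_bilinear.diff_right[OF B] by simp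
    also have "norm \<dots> \<le> norm (L (y - x)) * norm (g y - g x) * K"
      by (rule K(2))
    also have "\<dots> \<le> (norm (y - x) * M) * (e / (M * K)) * K"
      using d(2)[of y] that K(1) M(1) \<open>e > 0\<close>
      by (intro mult_right_mono mult_mono M(2)) (auto simp: dist_norm)
    also have "\<dots> = e * norm (y - x)"
      using K(1) M(1) by simp
    finally show ?thesis .
  qed
  then show "\<exists>d>0. \<forall>y. norm (y - x) < d \<longrightarrow>
      norm (B (L y) (g y) - B (L x) (g x) - B (L (y - x)) (g x)) \<le> e * norm (y - x)"
    using d(1) by blast
qed

text \<open>
  By the mean value inequality on the vertical segment from the real axis to \<open>z\<close>, the quotient
  \<open>F z / Im z\<close> differs from the vertical derivative at a real point \<open>c\<close> by at most the
  oscillation of the derivative near \<open>c\<close>.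
\<close>

lemma C1_difference_quotient_continuous:
  fixes F :: "complex \<Rightarrow> 'b::real_normed_vector" and F' :: "complex \<Rightarrow> complex \<Rightarrow>\<^sub>L 'b"
  assumes D: "open D"
    and F': "\<And>z. z \<in> D \<Longrightarrow> (F has_derivative blinfun_apply (F' z)) (at z)"
    and cont: "continuous_on D F'"
    and zero: "\<And>z. z \<in> D \<Longrightarrow> Im z = 0 \<Longrightarrow> F z = 0"
  shows "continuous_on D (\<lambda>z. if Im z = 0 then F' z \<i> else (1 / Im z) *\<^sub>R F z)"
    (is "continuous_on D ?Q")
proof (rule continuous_at_imp_continuous_on, rule ballI)
  fix c assume c: "c \<in> D"
  show "isCont ?Q c"
  proof (cases "Im c = 0")
    case False
    have "isCont (\<lambda>z. (1 / Im z) *\<^sub>R F z) c"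
      using False has_derivative_continuous[OF F'[OF c]]
      by (intro continuous_scaleR continuous_divide continuous_const isCont_Im continuous_ident)
          auto
    moreover have eq: "\<forall>\<^sub>F z in nhds c. ?Q z = (1 / Im z) *\<^sub>R F z"
    proof (rule eventually_nhds_in_open[THEN eventually_mono])
      show "open {z. Im z \<noteq> 0}"
        by (intro open_Collect_neq continuous_intros)
    qed (use False in auto)
    ultimately show ?thesis
      unfolding isCont_cong[OF eq] by simp
  next
    case True
    show ?thesis
      unfolding continuous_at_eps_delta
    proof (intro allI impI)
      fix e :: real assume "e > 0"
      have "isCont F' c"
        using cont D c by (simp add: continuous_on_eq_continuous_at)
      then obtain d1 where d1: "d1 > 0" "\<And>z. dist z c < d1 \<Longrightarrow> dist (F' z) (F' c) < e / 2"
        using \<open>e > 0\<close> unfolding continuous_at_eps_delta half_gt_zero_iff[symmetric, of e] by blast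
      obtain d2 where d2: "d2 > 0" "ball c d2 \<subseteq> D"
        using D c openE by blast
      define d where "d = min d1 d2"
      have "dist (?Q z) (?Q c) < e" if z: "dist z c < d" for z
      proof -
        have near: "norm (F' w - F' c) \<le> e / 2" if "w \<in> ball c d" for w
          using d1(2)[of w] that by (simp add: d_def dist_norm norm_minus_commute)
        have "norm (?Q z - F' c \<i>) \<le> e / 2"
        proof (cases "Im z = 0")
          case True
          have "norm (F' z \<i> - F' c \<i>) \<le> norm (F' z - F' c) * norm \<i>"
            using norm_blinfun[of "F' z - F' c" \<i>] by (simp add: minus_blinfun.rep_eq)
          also have "\<dots> \<le> e / 2"
            using near[of z] z by (simp add: dist_commute)
          finally show ?thesis using True by simp
        next
          case False
          let ?r = "of_real (Re z) :: complex"
          have re: "dist ?r c < d"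
          proof -
            have "dist ?r c = \<bar>Re (z - c)\<bar>"
              using True by (simp add: dist_norm cmod_def)
            also have "\<dots> \<le> dist z c"
              by (metis abs_Re_le_cmod dist_norm)
            finally show ?thesis using z by simp
          qed
          have rD: "?r \<in> D"
            using re d2(2) by (auto simp: d_def dist_commute)
          \<comment> \<open>The foot \<open>?r\<close> of the vertical segment is a zero of \<open>F\<close>, as it is real.\<close>
          have "norm (F z - F ?r - F' c (z - ?r)) \<le> norm (z - ?r) * (e / 2)"
          proof (rule differentiable_bound_linearization[where S = "ball c d"
              and f' = "\<lambda>w. blinfun_apply (F' w)"])
            show "?r + t *\<^sub>R (z - ?r) \<in> ball c d" if "t \<in> {0..1}" for t
              using convexD_alt[OF convex_ball[of c d], of ?r z t] re z that
              by (simp add: dist_commute algebra_simps)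
            show "(F has_derivative blinfun_apply (F' w)) (at w within ball c d)"
                if "w \<in> ball c d" for w
              by (rule has_derivative_at_withinI[OF F']) (use that d2(2) in \<open>auto simp: d_def\<close>)
            show "onorm (blinfun_apply (F' w) - blinfun_apply (F' c)) \<le> e / 2" if "w \<in> ball c d"
                for w
              using near[OF that] by (simp add: norm_blinfun.rep_eq minus_blinfun.rep_eq
                  fun_diff_def)
            show "c \<in> ball c d"
              using d1(1) d2(1) by (simp add: d_def)
          qed
          moreover have zr: "z - ?r = Im z *\<^sub>R \<i>"
            by (simp add: complex_eq_iff)
          ultimately have "norm (F z - Im z *\<^sub>R F' c \<i>) \<le> \<bar>Im z\<bar> * (e / 2)"
            using zero[OF rD] by (simp add: blinfun.scaleR_right)
          moreover have "F z - Im z *\<^sub>R F' c \<i> = Im z *\<^sub>R (?Q z - F' c \<i>)"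
            using False by (simp add: scaleR_diff_right)
          ultimately show ?thesis
            using False by simp
        qed
        then show ?thesis
          using True \<open>e > 0\<close> by (simp add: dist_norm)
      qed
      then show "\<exists>d>0. \<forall>z. dist z c < d \<longrightarrow> dist (?Q z) (?Q c) < e"
        using d1(1) d2(1) by (intro exI[of _ d]) (auto simp: d_def)
    qed
  qed
qed

lemma eq_uminus_imp_zero: "y = - y \<Longrightarrow> y = 0" for y :: "'w::real_vector"
  by (metis add.left_inverse scaleR_2 scaleR_eq_0_iff zero_neq_numeral)

lemma has_derivative_cnj:
  assumes "(h has_derivative h') (at z)" "Im z = 0"
  shows "((\<lambda>w. h (cnj w)) has_derivative (\<lambda>w. h' (cnj w))) (at z)"
proof -
  have "cnj z = z" using assms(2) by (simp add: complex_eq_iff)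
  then show ?thesis
    using has_derivative_compose[OF bounded_linear_imp_has_derivative[OF bounded_linear_cnj], of
        h h' z UNIV] assms(1)
    by simp
qed

text \<open>
  At a real point the derivative of \<open>h = h \<circ> cnj\<close> is invariant under conjugation, hence vanishes
  on \<open>\<i>\<close>. The next lemma is the counterpart for odd functions.
\<close>

lemma even_derivative_imaginary:
  assumes D: "open D" "z \<in> D" "Im z = 0" and h: "(h has_derivative h') (at z)"
    and even: "\<And>w. w \<in> D \<Longrightarrow> h (cnj w) = h w"
  shows "h' \<i> = 0"
proof -
  have "(h has_derivative (\<lambda>w. h' (cnj w))) (at z)"
    by (rule has_derivative_transform_within_open[OF has_derivative_cnj[OF h D(3)] D(1,2) even])
  then have "h' = (\<lambda>w. h' (cnj w))"
    by (rule has_derivative_unique[OF h])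
  then have "h' \<i> = h' (cnj \<i>)"
    by (rule fun_cong)
  also have "\<dots> = - h' \<i>"
    using linear_neg[OF has_derivative_linear[OF h], of \<i>] by simp
  finally show ?thesis
    by (rule eq_uminus_imp_zero)
qed

lemma odd_derivative_real:
  assumes D: "open D" "z \<in> D" "Im z = 0" and h: "(h has_derivative h') (at z)"
    and odd: "\<And>w. w \<in> D \<Longrightarrow> h (cnj w) = - h w"
  shows "h' 1 = 0"
proof -
  have "((\<lambda>w. - h w) has_derivative (\<lambda>w. h' (cnj w))) (at z)"
    by (rule has_derivative_transform_within_open[OF has_derivative_cnj[OF h D(3)] D(1,2) odd])
  then have "(\<lambda>w. - h' w) = (\<lambda>w. h' (cnj w))"
    by (rule has_derivative_unique[OF has_derivative_minus[OF h]])
  then have "- h' 1 = h' (cnj 1)"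
    by (rule fun_cong)
  then show ?thesis
    using eq_uminus_imp_zero[of "h' 1"] by simp
qed

text \<open>
  At a real point the increment of \<open>axial_point\<close> has the norm of the increment of \<open>x\<close>, so error
  estimates carry over although \<open>axial_point\<close> is not differentiable; its imaginary part, which
  causes the failure, is annihilated by \<open>h'\<close>.
\<close>

lemma has_derivative_axial_even:
  assumes h: "(h has_derivative h') (at (axial_point x))" and zero: "h' \<i> = 0" "snd x = 0"
  shows "((\<lambda>y. h (axial_point y)) has_derivative (\<lambda>y. fst y *\<^sub>R h' 1)) (at x)"
  unfolding has_derivative_at_alt
proof (intro conjI allI impI)
  show "bounded_linear (\<lambda>y. fst y *\<^sub>R h' 1)"
    by (intro bounded_linear_scaleR_const bounded_linear_fst)
  fix e :: real assume "e > 0"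
  then obtain d where d: "d > 0" "\<And>w. norm (w - axial_point x) < d \<Longrightarrow>
      norm (h w - h (axial_point x) - h' (w - axial_point x)) \<le> e * norm (w - axial_point x)"
    using h unfolding has_derivative_at_alt by blast
  have lin: "h' (axial_point y - axial_point x) = fst (y - x) *\<^sub>R h' 1" for y
  proof -
    have "axial_point y - axial_point x = fst (y - x) *\<^sub>R 1 + norm (snd y) *\<^sub>R \<i>"
      using zero(2) by (simp add: complex_eq_iff)
    then show ?thesis
      using zero(1) by (simp add: linear_add[OF has_derivative_linear[OF h]]
          linear_scale[OF has_derivative_linear[OF h]])
  qed
  show "\<exists>d>0. \<forall>y. norm (y - x) < d \<longrightarrow>
      norm (h (axial_point y) - h (axial_point x) - fst (y - x) *\<^sub>R h' 1) \<le> e * norm (y - x)"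
  proof (intro exI[of _ d] conjI allI impI)
    fix y assume "norm (y - x) < d"
    then show "norm (h (axial_point y) - h (axial_point x) - fst (y - x) *\<^sub>R h' 1) \<le> e * norm (y
        - x)"
      using d(2)[of "axial_point y"] unfolding norm_axial_point_diff_real[OF zero(2)] lin by blast
  qed (rule d(1))
qed

lemma bounded_bilinear_inner_scaleR:
  "bounded_bilinear (\<lambda>a k. (a \<bullet> v) *\<^sub>R k)" for v :: "'v::real_inner"
  using bounded_bilinear.comp1[OF bounded_bilinear_scaleR bounded_linear_inner_left] .

text \<open>
  Let \<open>z = x\<^sub>0 + \<i> |v|\<close> and \<open>\<omega> = v / |v|\<close>, and let \<open>Q\<close> be the difference quotient \<open>F\<^sub>2 / Im\<close>,
  extended to the real line by \<open>\<partial>\<^sub>\<beta> F\<^sub>2\<close>. The function is \<open>F\<^sub>1(z) + B v (Q z)\<close>, and off the real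
  points the chain rule gives its derivative in direction \<open>(h\<^sub>0, h)\<close> as

    \<open>h\<^sub>0 \<partial>\<^sub>\<alpha> F\<^sub>1 + (\<omega> \<bullet> h) \<partial>\<^sub>\<beta> F\<^sub>1 + B \<omega> (h\<^sub>0 \<partial>\<^sub>\<alpha> F\<^sub>2 + (\<omega> \<bullet> h) (\<partial>\<^sub>\<beta> F\<^sub>2 - Q)) + B h Q\<close>.

  Parity makes \<open>\<partial>\<^sub>\<beta> F\<^sub>1\<close>, \<open>\<partial>\<^sub>\<alpha> F\<^sub>2\<close> and \<open>\<partial>\<^sub>\<beta> F\<^sub>2 - Q\<close> vanish on the real line, so every term with
  the discontinuous factor \<open>\<omega>\<close> extends continuously by zero. The same formula, with \<open>sgn 0 = 0\<close>
  in the place of \<open>\<omega>\<close>, is the derivative at the real points.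
\<close>

lemma C1_axially_symmetric:
  fixes F1 :: "complex \<Rightarrow> 'b::real_normed_vector" and F2 :: "complex \<Rightarrow> 'c::real_normed_vector"
    and B :: "'v::euclidean_space \<Rightarrow> 'c \<Rightarrow> 'b"
  assumes B: "bounded_bilinear B" and D: "open D" and cnj: "\<And>z. z \<in> D \<Longrightarrow> cnj z \<in> D"
    and F1: "F1 \<in> C1 D" and F2: "F2 \<in> C1 D"
    and even: "\<And>z. z \<in> D \<Longrightarrow> F1 (cnj z) = F1 z"
    and odd: "\<And>z. z \<in> D \<Longrightarrow> F2 (cnj z) = - F2 z"
  shows "(\<lambda>x. F1 (axial_point x) + B (sgn (snd x)) (F2 (axial_point x))) \<in>
    C1 (axial_point -` D :: (real \<times> 'v) set)"
proof -
  obtain d1 where d1: "\<And>z. z \<in> D \<Longrightarrow> (F1 has_derivative blinfun_apply (d1 z)) (at z)"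
    and c1: "continuous_on D d1" using F1 by (rule C1E) blast
  obtain d2 where d2: "\<And>z. z \<in> D \<Longrightarrow> (F2 has_derivative blinfun_apply (d2 z)) (at z)"
    and c2: "continuous_on D d2" using F2 by (rule C1E) blast
  have F2_0: "F2 z = 0" if "z \<in> D" "Im z = 0" for z
  proof -
    have "cnj z = z" using that(2) by (simp add: complex_eq_iff)
    then have "F2 z = - F2 z" using odd[OF that(1)] by simp
    then show ?thesis by (rule eq_uminus_imp_zero)
  qed
  have d1_0: "d1 z \<i> = 0" if "z \<in> D" "Im z = 0" for z
    using even_derivative_imaginary[OF D that d1 even] that by simp
  define Q where "Q z = (if Im z = 0 then d2 z \<i> else (1 / Im z) *\<^sub>R F2 z)" for z
  have cQ: "continuous_on D Q"
    unfolding Q_def using D d2 c2 F2_0 by (rule C1_difference_quotient_continuous)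
  have F2_Q: "F2 z = Im z *\<^sub>R Q z" if "z \<in> D" for z
    using F2_0[OF that] by (simp add: Q_def)
  let ?U = "axial_point -` D :: (real \<times> 'v) set"
  have U: "open ?U"
    using D continuous_on_axial_point by (rule open_vimage)
  let ?f = "\<lambda>x :: real \<times> 'v. F1 (axial_point x) + B (sgn (snd x)) (F2 (axial_point x))"
  let ?f' = "\<lambda>x h. (fst h *\<^sub>R d1 (axial_point x) 1
      + (sgn (snd x) \<bullet> snd h) *\<^sub>R d1 (axial_point x) \<i>) +
    (B (sgn (snd x)) (fst h *\<^sub>R d2 (axial_point x) 1 +
      (sgn (snd x) \<bullet> snd h) *\<^sub>R (d2 (axial_point x) \<i> - Q (axial_point x))) +
     B (snd h) (Q (axial_point x)))"
  show ?thesis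
  proof (rule C1I[where f' = ?f'])
    fix x assume "x \<in> ?U"
    then have z: "axial_point x \<in> D" by simp
    show "(?f has_derivative ?f' x) (at x)"
    \<comment> \<open>At real points \<open>B v (Q z)\<close> is differentiated directly, since \<open>Q\<close> is only continuous there.\<close>
    proof (cases "snd x = 0")
      case True
      have real: "Im (axial_point x) = 0" using True by simp
      have "((\<lambda>y. F1 (axial_point y)) has_derivative (\<lambda>h. fst h *\<^sub>R d1 (axial_point x) 1)) (at x)"
        by (rule has_derivative_axial_even[OF d1[OF z] d1_0[OF z real] True])
      moreover have "((\<lambda>y. B (snd y) (Q (axial_point y)))
          has_derivative (\<lambda>h. B (snd h) (Q (axial_point x)))) (at x)"
      proof (rule has_derivative_bilinear_vanishing[OF B bounded_linear_snd True])
        have "continuous_on ?U (\<lambda>y. Q (axial_point y))"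
          by (rule continuous_on_compose2[OF cQ continuous_on_axial_point]) simp
        then show "isCont (\<lambda>y. Q (axial_point y)) x"
          using U \<open>x \<in> ?U\<close> continuous_on_eq_continuous_at by blast
      qed
      ultimately have "((\<lambda>y. F1 (axial_point y)
          + B (snd y) (Q (axial_point y))) has_derivative ?f' x) (at x)"
        using True bounded_bilinear.zero_left[OF B] by (auto dest: has_derivative_add)
      then show ?thesis
      proof (rule has_derivative_transform_within_open[OF _ U \<open>x \<in> ?U\<close>])
        fix y assume "y \<in> ?U"
        then have "F2 (axial_point y) = norm (snd y) *\<^sub>R Q (axial_point y)"
          using F2_Q by simp
        moreover have "norm (snd y) *\<^sub>R sgn (snd y) = snd y"
          by (cases "snd y = 0") (simp_all add: sgn_div_norm)
        ultimately show "F1 (axial_point y) + B (snd y) (Q (axial_point y)) = ?f y"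
          using bounded_bilinear.scaleR_left[OF B] bounded_bilinear.scaleR_right[OF B]
          by metis
      qed
    next
      case False
      let ?z = "axial_point x" and ?w = "\<lambda>h :: real \<times> 'v. sgn (snd x) \<bullet> snd h"
      have decomp: "Complex a b = a *\<^sub>R 1 + b *\<^sub>R \<i>" for a b
        by (simp add: complex_eq_iff)
      have D1: "((\<lambda>y. F1 (axial_point y)) has_derivative (\<lambda>h. fst h *\<^sub>R d1 ?z 1
          + ?w h *\<^sub>R d1 ?z \<i>)) (at x)"
        using has_derivative_compose[OF has_derivative_axial_point[OF False] d1[OF z]]
        unfolding decomp blinfun.add_right blinfun.scaleR_right .
      have D2: "((\<lambda>y. F2 (axial_point y)) has_derivative (\<lambda>h. fst h *\<^sub>R d2 ?z 1
          + ?w h *\<^sub>R d2 ?z \<i>)) (at x)"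
        using has_derivative_compose[OF has_derivative_axial_point[OF False] d2[OF z]]
        unfolding decomp blinfun.add_right blinfun.scaleR_right .
      have N: "((\<lambda>y :: real \<times> 'v. inverse (norm (snd y))) has_derivative
          (\<lambda>h. - (inverse (norm (snd x)) * ?w h * inverse (norm (snd x))))) (at x)"
        using False by (intro Deriv.has_derivative_inverse has_derivative_norm_snd) simp_all
      have "((\<lambda>y. F1 (axial_point y) + B (snd y) (inverse (norm (snd y)) *\<^sub>R F2 (axial_point
          y))) has_derivative
          (\<lambda>h. (fst h *\<^sub>R d1 ?z 1 + ?w h *\<^sub>R d1 ?z \<i>) +
            (B (snd x) (inverse (norm (snd x)) *\<^sub>R (fst h *\<^sub>R d2 ?z 1 + ?w h *\<^sub>R d2 ?z \<i>) +
              (- (inverse (norm (snd x)) * ?w h * inverse (norm (snd x)))) *\<^sub>R F2 ?z) +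
             B (snd h) (inverse (norm (snd x)) *\<^sub>R F2 ?z)))) (at x)"
        by (intro has_derivative_add D1 bounded_bilinear.FDERIV[OF B] has_derivative_snd
            has_derivative_ident has_derivative_scaleR N D2)
      moreover have "B (snd y) (inverse (norm (snd y)) *\<^sub>R k) = B (sgn (snd y)) k"
          for y :: "real \<times> 'v" and k
        by (simp add: sgn_div_norm bounded_bilinear.scaleR_left[OF B]
            bounded_bilinear.scaleR_right[OF B])
      moreover have "inverse (norm (snd x)) *\<^sub>R (fst h *\<^sub>R d2 ?z 1 + ?w h *\<^sub>R d2 ?z \<i>) +
          (- (inverse (norm (snd x)) * ?w h * inverse (norm (snd x)))) *\<^sub>R F2 ?z =
          inverse (norm (snd x)) *\<^sub>R (fst h *\<^sub>R d2 ?z 1 + ?w h *\<^sub>R (d2 ?z \<i> - Q ?z))" for h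
        using False by (simp add: Q_def algebra_simps divide_inverse)
      moreover have "inverse (norm (snd x)) *\<^sub>R F2 ?z = Q ?z"
        using False by (simp add: Q_def divide_inverse)
      ultimately show ?thesis
        by simp
    qed
  next
    fix h :: "real \<times> 'v"
    have c: "continuous_on ?U (\<lambda>x. k (axial_point x))" if "continuous_on D k"
      for k :: "complex \<Rightarrow> 'w::real_normed_vector"
      by (rule continuous_on_compose2[OF that continuous_on_axial_point]) simp
    have capp: "continuous_on D (\<lambda>z. d1 z w)" "continuous_on D (\<lambda>z. d2 z w)" for w
      by (intro bounded_bilinear.continuous_on[OF bounded_bilinear_blinfun_apply] c1 c2
          continuous_on_const)+
    have d1_i: "continuous_on ?U (\<lambda>x. (sgn (snd x) \<bullet> snd h) *\<^sub>R d1 (axial_point x) \<i>)"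
      by (rule continuous_on_sgn_times_vanishing[OF bounded_bilinear_inner_scaleR])
        (use c[OF capp(1)] d1_0 in auto)
    have "continuous_on ?U (\<lambda>x. (sgn (snd x) \<bullet> snd h) *\<^sub>R (d2 (axial_point x) \<i>
        - Q (axial_point x)))"
      by (rule continuous_on_sgn_times_vanishing[OF bounded_bilinear_inner_scaleR],
          intro continuous_on_diff c capp(2) cQ) (simp add: Q_def)
    then have "continuous_on ?U (\<lambda>x. fst h *\<^sub>R d2 (axial_point x) 1 +
        (sgn (snd x) \<bullet> snd h) *\<^sub>R (d2 (axial_point x) \<i> - Q (axial_point x)))"
      by (rule continuous_on_add[OF continuous_on_scaleR[OF continuous_on_const c[OF capp(2)]]])
    then have B_sgn: "continuous_on ?U (\<lambda>x. B (sgn (snd x)) (fst h *\<^sub>R d2 (axial_point x) 1 +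
        (sgn (snd x) \<bullet> snd h) *\<^sub>R (d2 (axial_point x) \<i> - Q (axial_point x))))"
      by (rule continuous_on_sgn_times_vanishing[OF B])
        (use odd_derivative_real[OF D _ _ d2 odd] in auto)
    show "continuous_on ?U (\<lambda>x. ?f' x h)"
      by (rule continuous_on_add[OF
            continuous_on_add[OF continuous_on_scaleR[OF continuous_on_const c[OF capp(1)]] d1_i]
            continuous_on_add[OF B_sgn
              bounded_bilinear.continuous_on[OF B continuous_on_const c[OF cQ]]]])
  qed
qed

section \<open>Slices of circular sets\<close>

lemma bounded_linear_slice_map: "bounded_linear (slice_map I)"
  by (subst linear_conv_bounded_linear[symmetric])
    (auto simp: slice_map_def algebra_simps scaleR_Pair intro!: linearI)

lemma snd_slice_map [simp]: "snd (slice_map I z) = Im z *\<^sub>R snd I"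
  by (simp add: slice_map_def)

lemma fst_slice_map: "I \<in> imag_units \<Longrightarrow> fst (slice_map I z) = Re z"
  by (simp add: slice_map_def imag_units_iff)

lemma slice_map_uminus_cnj: "slice_map (- I) (cnj z) = slice_map I z"
  by (simp add: slice_map_def)

lemma cl_uminus: "cl (- x) = - cl x"
  by (rule linear_neg[OF bounded_linear.linear[OF bounded_linear_cl]])

lemma axial_point_slice_map:
  "I \<in> imag_units \<Longrightarrow> axial_point (slice_map I z) = Complex (Re z) \<bar>Im z\<bar>"
  by (simp add: axial_point_def fst_slice_map) (simp add: imag_units_iff)

text \<open>
  A nonreal paravector lies in exactly one plane, which is parametrised by the two units \<open>I\<close> and
  \<open>- I\<close>; a real one lies in all planes.
\<close>

lemma slice_map_eq_cases:
  assumes I: "I \<in> imag_units" "J \<in> imag_units" and eq: "slice_map I z = slice_map J w"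
  obtains "w = z" "Im z = 0 \<or> J = I" | "w = cnj z" "J = - I"
proof -
  have re: "Re z = Re w" and im: "Im z *\<^sub>R snd I = Im w *\<^sub>R snd J"
    using arg_cong[OF eq, of fst] arg_cong[OF eq, of snd] I by (simp_all add: fst_slice_map)
  have "\<bar>Im z\<bar> = \<bar>Im w\<bar>"
    using arg_cong[OF im, of norm] I by (simp add: imag_units_iff)
  then consider "Im w = Im z" | "Im w = - Im z" "Im z \<noteq> 0"
    by fastforce
  then show thesis
  proof cases
    case 1
    then have "Im z = 0 \<or> J = I"
      using im I by (auto simp: imag_units_iff prod_eq_iff)
    then show thesis
      using 1 re that(1) by (simp add: complex_eq_iff)
  next
    case 2
    then have "Im z *\<^sub>R snd I = Im z *\<^sub>R (- snd J)"
      using im by simp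
    then have "snd I = - snd J"
      using 2(2) unfolding scaleR_cancel_left by simp
    then have "J = - I"
      using I by (simp add: imag_units_iff prod_eq_iff)
    then show thesis
      using 2 re that(2) by (simp add: complex_eq_iff)
  qed
qed

lemma inj_slice_map: "I \<in> imag_units \<Longrightarrow> inj (slice_map I)"
proof (rule injI)
  fix z w assume I: "I \<in> imag_units" and eq: "slice_map I z = slice_map I w"
  have "I \<noteq> - I"
  proof
    assume "I = - I"
    then have "I = 0" by (rule eq_uminus_imp_zero)
    then show False using I by (simp add: imag_units_iff)
  qed
  show "z = w"
    by (rule slice_map_eq_cases[OF I I eq]) (use \<open>I \<noteq> - I\<close> in auto)
qed

lemma paravector_in_slice:
  obtains I where "I \<in> imag_units" "x = slice_map I (axial_point x)"
    "snd x \<noteq> 0 \<Longrightarrow> I = (0, sgn (snd x))"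
proof (cases "snd x = 0")
  case True
  obtain I :: "'a paravector" where "I \<in> imag_units"
    using imag_units_nonempty by blast
  then show ?thesis
    using True by (intro that[of I]) (auto simp: prod_eq_iff fst_slice_map)
next
  case False
  then have "(0, sgn (snd x)) \<in> imag_units"
    by (simp add: imag_units_iff norm_sgn)
  then show ?thesis
    using False by (intro that[of "(0, sgn (snd x))"]) (auto simp: prod_eq_iff fst_slice_map
        sgn_div_norm)
qed

lemma slice_map_in_circularization:
  assumes I: "I \<in> imag_units"
  shows "slice_map I z \<in> circularization E \<longleftrightarrow> z \<in> E \<or> cnj z \<in> E"
proof
  assume "slice_map I z \<in> circularization E"
  then obtain J w where J: "J \<in> imag_units" "w \<in> E" "slice_map I z = slice_map J w"
    unfolding circularization_def by blast
  show "z \<in> E \<or> cnj z \<in> E"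
    by (rule slice_map_eq_cases[OF I J(1,3)]) (use J(2) in auto)
next
  assume "z \<in> E \<or> cnj z \<in> E"
  then show "slice_map I z \<in> circularization E"
    unfolding circularization_def
    using I uminus_imag_units[OF I] slice_map_uminus_cnj[of I z]
    by (metis (mono_tags, lifting) mem_Collect_eq)
qed

lemma circular_slice_iff:
  assumes "circular \<Omega>" "I \<in> imag_units"
  shows "slice_map I z \<in> \<Omega> \<longleftrightarrow> z \<in> stem_domain \<Omega>"
  using assms slice_map_in_circularization imag_units_nonempty
  unfolding circular_def stem_domain_def by blast

lemma circular_iff_axial_point:
  assumes "circular \<Omega>"
  shows "x \<in> \<Omega> \<longleftrightarrow> axial_point x \<in> stem_domain \<Omega>"
  by (metis paravector_in_slice circular_slice_iff[OF assms])

lemma stem_domain_cnj: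
  assumes "circular \<Omega>" "z \<in> stem_domain \<Omega>"
  shows "cnj z \<in> stem_domain \<Omega>"
proof -
  obtain I :: "'a paravector" where I: "I \<in> imag_units"
    using imag_units_nonempty by blast
  have "slice_map (- I) (cnj z) \<in> \<Omega>"
    using circular_slice_iff[OF assms(1) I] assms(2) by (simp add: slice_map_uminus_cnj)
  then show ?thesis
    using circular_slice_iff[OF assms(1) uminus_imag_units[OF I]] by simp
qed

lemma open_stem_domain:
  assumes "circular \<Omega>" "open \<Omega>"
  shows "open (stem_domain \<Omega>)"
proof -
  obtain I :: "'a paravector" where I: "I \<in> imag_units"
    using imag_units_nonempty by blast
  have "open (slice_map I -` \<Omega>)"
    by (rule open_vimage[OF assms(2) linear_continuous_on[OF bounded_linear_slice_map]])
  also have "slice_map I -` \<Omega> = stem_domain \<Omega>"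
    by (rule set_eqI) (simp add: circular_slice_iff[OF assms(1) I])
  finally show ?thesis .
qed

lemma real_paravectors_iff: "x \<in> real_paravectors \<longleftrightarrow> snd x = 0"
  by (cases x) (auto simp: real_paravectors_def)

lemma stem_domain_meets_reals:
  assumes "circular \<Omega>" "\<Omega> \<inter> real_paravectors \<noteq> {}"
  shows "stem_domain \<Omega> \<inter> \<real> \<noteq> {}"
proof -
  obtain x where "x \<in> \<Omega>" "snd x = 0"
    using assms(2) real_paravectors_iff by blast
  then have "axial_point x \<in> stem_domain \<Omega>" "axial_point x \<in> \<real>"
    using circular_iff_axial_point[OF assms(1)] by (simp_all add: complex_is_Real_iff)
  then show ?thesis by blast
qed

text \<open>
  The upper half of the stem domain is the image of \<open>\<Omega>\<close> under \<open>axial_point\<close>, the lower half is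
  its mirror image, and the two halves meet at a real point of \<open>\<Omega>\<close>.
\<close>

lemma connected_stem_domain:
  assumes circ: "circular \<Omega>" and "connected \<Omega>" and real: "\<Omega> \<inter> real_paravectors \<noteq> {}"
  shows "connected (stem_domain \<Omega>)"
proof -
  let ?H = "axial_point ` \<Omega>"
  have "connected ?H"
    using connected_continuous_image[OF continuous_on_axial_point assms(2)] .
  moreover have "connected (cnj ` ?H)"
    by (rule connected_continuous_image[OF continuous_on_cnj[OF continuous_on_id] \<open>connected ?H\<close>])
  moreover have "?H \<inter> cnj ` ?H \<noteq> {}"
  proof -
    obtain x where x: "x \<in> \<Omega>" "snd x = 0"
      using real real_paravectors_iff by blast
    then have "cnj (axial_point x) = axial_point x"
      by (simp add: complex_eq_iff)
    then show ?thesis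
      using x(1) by (metis IntI empty_iff imageI)
  qed
  moreover have "stem_domain \<Omega> = ?H \<union> cnj ` ?H"
  proof (intro equalityI subsetI)
    fix z assume z: "z \<in> stem_domain \<Omega>"
    obtain I :: "'a paravector" where I: "I \<in> imag_units"
      using imag_units_nonempty by blast
    have x: "slice_map I z \<in> \<Omega>"
      using z circular_slice_iff[OF circ I] by simp
    have "z = axial_point (slice_map I z) \<or> z = cnj (axial_point (slice_map I z))"
      by (auto simp: axial_point_slice_map[OF I] complex_eq_iff abs_if)
    then show "z \<in> ?H \<union> cnj ` ?H"
      using x by blast
  next
    fix z assume "z \<in> ?H \<union> cnj ` ?H"
    then show "z \<in> stem_domain \<Omega>"
      using circular_iff_axial_point[OF circ] stem_domain_cnj[OF circ] by auto
  qed
  ultimately show ?thesis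
    by (simp add: connected_Un)
qed

section \<open>The slice operator\<close>

lemma dbar_slice_slice_map:
  assumes "I \<in> imag_units"
  shows "dbar_slice I f (slice_map I z) = (1 / 2) *\<^sub>R
    (partial_deriv 1 (f \<circ> slice_map I) z + cl I * partial_deriv \<i> (f \<circ> slice_map I) z)"
  by (simp add: dbar_slice_def Let_def inv_f_f[OF inj_slice_map[OF assms]])

lemma dbar_slice_zero_iff_left_holomorphic:
  assumes "I \<in> imag_units" "open D" "f \<circ> slice_map I \<in> C1 D"
  shows "left_holomorphic (cl I) D (f \<circ> slice_map I) \<longleftrightarrow>
    (\<forall>z\<in>D. dbar_slice I f (slice_map I z) = 0)"
  using assms by (simp add: left_holomorphic_iff cl_imag_unit_square dbar_slice_slice_map)

lemma C1_slice_dbar_iff: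
  assumes circ: "circular \<Omega>" and "open \<Omega>"
  shows "f \<in> C1_slice \<Omega> \<and> (\<forall>I\<in>imag_units. \<forall>x\<in>\<Omega> \<inter> slice_plane I. dbar_slice I f x = 0) \<longleftrightarrow>
    (\<forall>I\<in>imag_units. left_holomorphic (cl I) (stem_domain \<Omega>) (f \<circ> slice_map I))"
proof -
  note D = open_stem_domain[OF circ \<open>open \<Omega>\<close>]
  have slice: "(\<forall>x\<in>\<Omega> \<inter> slice_plane I. dbar_slice I f x = 0) \<longleftrightarrow>
      (\<forall>z\<in>stem_domain \<Omega>. dbar_slice I f (slice_map I z) = 0)" if "I \<in> imag_units" for I
    using circular_slice_iff[OF circ that] by (auto simp: slice_plane_def)
  have "f \<circ> slice_map I \<in> C1 (stem_domain \<Omega>) \<and> (\<forall>x\<in>\<Omega> \<inter> slice_plane I. dbar_slice I f x = 0) \<longleftrightarrow>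
      left_holomorphic (cl I) (stem_domain \<Omega>) (f \<circ> slice_map I)" if "I \<in> imag_units" for I
    unfolding slice[OF that]
    using dbar_slice_zero_iff_left_holomorphic[OF that D, of f]
      left_holomorphic_imp_C1[OF D, of "cl I" "f \<circ> slice_map I"] by blast
  then show ?thesis
    unfolding C1_slice_def by blast
qed

lemma C1_imp_C1_slice:
  assumes "circular \<Omega>" "f \<in> C1 \<Omega>"
  shows "f \<in> C1_slice \<Omega>"
  unfolding C1_slice_def
proof (intro CollectI ballI)
  fix I :: "'a paravector" assume "I \<in> imag_units"
  then have "slice_map I ` stem_domain \<Omega> \<subseteq> \<Omega>"
    using circular_slice_iff[OF assms(1)] by blast
  then show "f \<circ> slice_map I \<in> C1 (stem_domain \<Omega>)"
    by (rule C1_compose[OF assms(2) C1_bounded_linear[OF bounded_linear_slice_map]])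
qed

text \<open>
  Along the plane of \<open>I\<close> the vector \<open>Im x = \<beta> I\<close> gives \<open>\<Sum>\<^sub>h x\<^sub>h \<partial>\<^sub>h = \<beta> \<partial>\<^sub>\<beta>\<close> and
  \<open>Im x / |Im x|\<^sup>2 = I / \<beta>\<close>, so the two operators agree off the real axis.
\<close>

lemma thetabar_slice_map:
  assumes f: "(f has_derivative f') (at (slice_map I z))" and I: "I \<in> imag_units" and "Im z \<noteq> 0"
  shows "thetabar f (slice_map I z) = dbar_slice I f (slice_map I z)"
proof -
  let ?x = "slice_map I z" and ?v = "snd I"
  note lin = has_derivative_linear[OF f]
  have I0: "I = (0, ?v)" and n: "norm ?v = 1"
    using I by (simp_all add: imag_units_iff prod_eq_iff)
  have comp: "((f \<circ> slice_map I) has_derivative (\<lambda>h. f' (slice_map I h))) (at z)"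
    using has_derivative_compose[OF bounded_linear_imp_has_derivative[OF
        bounded_linear_slice_map] f]
    by (simp add: comp_def)
  have "(\<Sum>h\<in>UNIV. (snd ?x $ h) *\<^sub>R partial_deriv (e_axis h) f ?x) =
      (\<Sum>h\<in>UNIV. f' (0, (Im z * ?v $ h) *\<^sub>R axis h 1))"
    by (simp add: partial_deriv_eq[OF f] linear_scale[OF lin, symmetric] scaleR_Pair)
  also have "\<dots> = f' (\<Sum>h\<in>UNIV. (0, (Im z * ?v $ h) *\<^sub>R axis h 1))"
    by (rule linear_sum[OF lin, symmetric])
  also have "(\<Sum>h\<in>UNIV. (0 :: real, (Im z * ?v $ h) *\<^sub>R axis h (1 :: real))) = Im z *\<^sub>R I"
  proof -
    have "(\<Sum>h\<in>UNIV. (Im z * ?v $ h) *\<^sub>R axis h (1 :: real)) = Im z *\<^sub>R ?v"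
      using basis_expansion[of "Im z *\<^sub>R ?v"]
      by (simp add: vector_scalar_mult_def scalar_mult_eq_scaleR)
    then show ?thesis
      by (subst I0) (simp add: sum_prod prod_eq_iff fst_sum snd_sum)
  qed
  finally have radial: "(\<Sum>h\<in>UNIV. (snd ?x $ h) *\<^sub>R partial_deriv (e_axis h) f ?x) = Im z *\<^sub>R f' I"
    by (simp add: linear_scale[OF lin])
  have im: "im_part ?x = Im z *\<^sub>R I"
    by (subst (2) I0) (simp add: im_part_def)
  have nI: "norm I = 1"
    by (subst I0) (simp add: norm_prod_def n)
  have one: "slice_map I 1 = e0" and i: "slice_map I \<i> = I"
    by (simp_all add: slice_map_def zero_prod_def[symmetric])
  have "(Im z * Im z / (Im z)\<^sup>2) = 1"
    using \<open>Im z \<noteq> 0\<close> by (simp add: power2_eq_square)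
  then show ?thesis
    unfolding thetabar_def radial
    unfolding im dbar_slice_slice_map[OF I] partial_deriv_eq[OF comp]
      partial_deriv_eq[OF f] one i
    using linear_scale[OF bounded_linear.linear[OF bounded_linear_cl], of "Im z" I]
    by (simp add: nI mult.commute)
qed

lemma nonreal_part_iff: "x \<in> nonreal_part \<Omega> \<longleftrightarrow> x \<in> \<Omega> \<and> snd x \<noteq> 0"
  by (simp add: nonreal_part_def real_paravectors_iff)

lemma global_op_thetabar:
  assumes "snd x \<noteq> 0"
  shows "global_op f x = (2 * (norm (im_part x))\<^sup>2) *\<^sub>R thetabar f x"
proof -
  have "norm (im_part x) \<noteq> 0"
    using assms by (simp add: im_part_def zero_prod_def)
  then show ?thesis
    by (simp add: global_op_def thetabar_def scaleR_add_right)
qed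

lemma global_op_real: "snd x = 0 \<Longrightarrow> global_op f x = 0"
  using linear_0[OF bounded_linear.linear[OF bounded_linear_cl]]
  by (simp add: global_op_def im_part_def zero_prod_def)

lemma global_op_zero_iff:
  "(\<forall>x\<in>\<Omega>. global_op f x = 0) \<longleftrightarrow> (\<forall>x\<in>nonreal_part \<Omega>. thetabar f x = 0)"
proof -
  have "global_op f x = 0 \<longleftrightarrow> thetabar f x = 0" if "snd x \<noteq> 0" for x
    using that by (simp add: global_op_thetabar im_part_def zero_prod_def)
  then show ?thesis
    using global_op_real unfolding Ball_def nonreal_part_iff by metis
qed

section \<open>Slice functions and their stem functions\<close>

text \<open>
  The two parametrisations of a plane give the same value by the parity of \<open>F\<close>. At a real point
  the unit is arbitrary, but there the odd component vanishes.
\<close>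

lemma induced_slice_slice_map:
  assumes F: "stem_function D F" and I: "I \<in> imag_units" and z: "z \<in> D"
  shows "induced_slice D F (slice_map I z) = fst (F z) + cl I * snd (F z)"
  unfolding induced_slice_def
proof (rule the_equality)
  show "\<exists>w\<in>D. \<exists>J\<in>imag_units. slice_map I z = slice_map J w \<and>
      fst (F z) + cl I * snd (F z) = fst (F w) + cl J * snd (F w)"
    using I z by blast
next
  fix y assume "\<exists>w\<in>D. \<exists>J\<in>imag_units. slice_map I z = slice_map J w \<and> y = fst (F w)
      + cl J * snd (F w)"
  then obtain w J where J: "w \<in> D" "J \<in> imag_units" "slice_map I z = slice_map J w"
    and y: "y = fst (F w) + cl J * snd (F w)" by blast
  have stem: "fst (F (cnj z)) = fst (F z)" "snd (F (cnj z)) = - snd (F z)"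
    using F z by (simp_all add: stem_function_def)
  from I J(2,3) show "y = fst (F z) + cl I * snd (F z)"
  proof (cases rule: slice_map_eq_cases)
    case 1
    have "snd (F z) = 0" if "Im z = 0"
    proof (rule eq_uminus_imp_zero)
      have "cnj z = z" using that by (simp add: complex_eq_iff)
      then show "snd (F z) = - snd (F z)" using stem(2) by simp
    qed
    then show ?thesis
      using 1 by (auto simp: y)
  next
    case 2
    then show ?thesis
      by (simp add: y stem cl_uminus)
  qed
qed

lemma C1_stem_of_slice_map:
  assumes circ: "circular \<Omega>" and F: "C1_stem_of \<Omega> f F" and I: "I \<in> imag_units"
      and z: "z \<in> stem_domain \<Omega>"
  shows "f (slice_map I z) = fst (F z) + cl I * snd (F z)"
  using F circular_slice_iff[OF circ I, of z] z induced_slice_slice_map[OF _ I z, of F]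
  unfolding C1_stem_of_def by simp

text \<open>
  Differentiating the symmetry of \<open>F\<close> under conjugation: \<open>\<partial>\<^sub>\<alpha>\<close> preserves parity and \<open>\<partial>\<^sub>\<beta>\<close>
  reverses it.
\<close>

lemma stem_function_dbar_stem:
  assumes D: "open D" and cnj: "\<And>z. z \<in> D \<Longrightarrow> cnj z \<in> D"
    and F: "stem_function D F" "fst \<circ> F \<in> C1 D" "snd \<circ> F \<in> C1 D"
  shows "stem_function D (dbar_stem F)"
  unfolding stem_function_def
proof (rule ballI)
  fix z assume z: "z \<in> D"
  have stem: "(fst \<circ> F) w = (fst \<circ> F) (cnj w)" "- (snd \<circ> F) w = (snd \<circ> F) (cnj w)" if "w \<in> D" for w
    using F(1) that by (simp_all add: stem_function_def)
  obtain a1 a2 where a: "(fst \<circ> F has_derivative a1) (at z)" "(snd \<circ> F has_derivative a2) (at z)"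
    using C1_has_derivative[OF F(2) z] C1_has_derivative[OF F(3) z] by blast
  obtain b1 b2 where b: "(fst \<circ> F has_derivative b1) (at (cnj z))" "(snd \<circ> F
      has_derivative b2) (at (cnj z))"
    using C1_has_derivative[OF F(2) cnj[OF z]] C1_has_derivative[OF F(3) cnj[OF z]] by blast
  note reflect = has_derivative_compose[OF bounded_linear_imp_has_derivative[OF bounded_linear_cnj]]
  have "a1 = (\<lambda>h. b1 (cnj h))"
    by (rule has_derivative_unique[OF has_derivative_transform_within_open[OF a(1) D z stem(1)]
        reflect[OF b(1)]])
  then have 1: "a1 1 = b1 1" "a1 \<i> = - b1 \<i>"
    using linear_neg[OF has_derivative_linear[OF b(1)]] by simp_all
  have "(\<lambda>h. - a2 h) = (\<lambda>h. b2 (cnj h))"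
    by (rule has_derivative_unique[OF
          has_derivative_transform_within_open[OF has_derivative_minus[OF a(2)] D z stem(2)]
              reflect[OF b(2)]])
  then have "- a2 h = b2 (cnj h)" for h
    by (rule fun_cong)
  from this[of 1] this[of \<i>] have 2: "b2 1 = - a2 1" "b2 \<i> = a2 \<i>"
    using linear_neg[OF has_derivative_linear[OF b(2)]] by simp_all
  show "fst (dbar_stem F (cnj z)) = fst (dbar_stem F z) \<and> snd (dbar_stem F (cnj z)) =
      - snd (dbar_stem F z)"
    unfolding dbar_stem_def partial_deriv_eq[OF a(1)] partial_deriv_eq[OF a(2)]
      partial_deriv_eq[OF b(1)] partial_deriv_eq[OF b(2)]
    by (simp add: 1 2 scaleR_right_diff_distrib)
qed

text \<open>
  Multiplying out \<open>(\<partial>\<^sub>\<alpha> + I \<partial>\<^sub>\<beta>) (F\<^sub>1 + I F\<^sub>2)\<close> with \<open>I\<^sup>2 = -1\<close>.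
\<close>

lemma dbar_slice_stem:
  assumes circ: "circular \<Omega>" and opn: "open \<Omega>" and F: "C1_stem_of \<Omega> f F"
    and I: "I \<in> imag_units" and z: "z \<in> stem_domain \<Omega>"
  shows "dbar_slice I f (slice_map I z) = fst (dbar_stem F z) + cl I * snd (dbar_stem F z)"
proof -
  note D = open_stem_domain[OF circ opn]
  have C1: "fst \<circ> F \<in> C1 (stem_domain \<Omega>)" "snd \<circ> F \<in> C1 (stem_domain \<Omega>)"
    using F by (simp_all add: C1_stem_of_def)
  obtain a1 a2 where a: "(fst \<circ> F has_derivative a1) (at z)" "(snd \<circ> F has_derivative a2) (at z)"
    using C1_has_derivative[OF C1(1) z] C1_has_derivative[OF C1(2) z] by blast
  have "((\<lambda>w. (fst \<circ> F) w + cl I * (snd \<circ> F) w) has_derivative (\<lambda>h. a1 h + cl I * a2 h)) (at z)"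
    by (intro has_derivative_add a bounded_linear.has_derivative[OF
          bounded_bilinear.bounded_linear_right[OF bounded_bilinear_clifford_mult]])
  then have "(f \<circ> slice_map I has_derivative (\<lambda>h. a1 h + cl I * a2 h)) (at z)"
    by (rule has_derivative_transform_within_open[OF _ D z])
      (simp add: C1_stem_of_slice_map[OF circ F I])
  note d = partial_deriv_eq[OF this]
  show ?thesis
    unfolding dbar_slice_slice_map[OF I] d dbar_stem_def partial_deriv_eq[OF a(1)]
        partial_deriv_eq[OF a(2)]
    by (simp add: distrib_left imag_unit_cancel[OF I] scaleR_right_distrib
        scaleR_right_diff_distrib)
qed

text \<open>
  Whichever stem function is chosen to represent \<open>f\<close>, its conjugate derivative restricts on every
  slice to the intrinsic \<open>dbar_slice\<close>.
\<close>

lemma slice_deriv_conj_slice_map: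
  assumes circ: "circular \<Omega>" and opn: "open \<Omega>" and f: "f \<in> C1_slice_functions \<Omega>"
    and I: "I \<in> imag_units" and z: "z \<in> stem_domain \<Omega>"
  shows "slice_deriv_conj \<Omega> f (slice_map I z) = dbar_slice I f (slice_map I z)"
proof -
  define F where "F = (SOME F. C1_stem_of \<Omega> f F)"
  have F: "C1_stem_of \<Omega> f F"
    using f unfolding F_def C1_slice_functions_def mem_Collect_eq by (rule someI_ex)
  then have "stem_function (stem_domain \<Omega>) (dbar_stem F)"
    by (intro stem_function_dbar_stem open_stem_domain[OF circ opn] stem_domain_cnj[OF circ])
      (simp_all add: C1_stem_of_def)
  then show ?thesis
    unfolding slice_deriv_conj_def F_def[symmetric] dbar_slice_stem[OF circ opn F I z]
    by (rule induced_slice_slice_map[OF _ I z])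
qed

lemma slice_deriv_conj_zero_iff:
  assumes circ: "circular \<Omega>" and opn: "open \<Omega>" and f: "f \<in> C1_slice_functions \<Omega>"
  shows "(\<forall>x\<in>\<Omega>. slice_deriv_conj \<Omega> f x = 0) \<longleftrightarrow>
    (\<forall>I\<in>imag_units. \<forall>x\<in>\<Omega> \<inter> slice_plane I. dbar_slice I f x = 0)"
proof (intro iffI ballI)
  fix I x assume zero: "\<forall>x\<in>\<Omega>. slice_deriv_conj \<Omega> f x = 0"
    and I: "I \<in> imag_units" and x: "x \<in> \<Omega> \<inter> slice_plane I"
  obtain z where z: "x = slice_map I z"
    using x by (auto simp: slice_plane_def)
  have "z \<in> stem_domain \<Omega>"
    using x circular_slice_iff[OF circ I] by (simp add: z)
  then show "dbar_slice I f x = 0"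
    using zero x slice_deriv_conj_slice_map[OF circ opn f I, symmetric] by (simp add: z)
next
  fix x assume zero: "\<forall>I\<in>imag_units. \<forall>x\<in>\<Omega> \<inter> slice_plane I. dbar_slice I f x = 0"
    and x: "x \<in> \<Omega>"
  obtain I where I: "I \<in> imag_units" "x = slice_map I (axial_point x)"
    using paravector_in_slice by blast
  have "x \<in> \<Omega> \<inter> slice_plane I"
    using x I(2) by (auto simp: slice_plane_def)
  then have "dbar_slice I f x = 0"
    using zero I(1) by blast
  then show "slice_deriv_conj \<Omega> f x = 0"
    using slice_deriv_conj_slice_map[OF circ opn f I(1), of "axial_point x"]
      circular_iff_axial_point[OF circ] x I(2) by metis
qed

text \<open>
  On \<open>\<Omega>\<close> the slice function is \<open>F\<^sub>1(z) + \<omega> F\<^sub>2(z)\<close> with \<open>z = x\<^sub>0 + \<i> |Im x|\<close> and \<open>\<omega>\<close> the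
  direction of \<open>Im x\<close>. Setting \<open>\<omega> = 0\<close> at real points is harmless because \<open>F\<^sub>2\<close> vanishes there.
\<close>

lemma C1_slice_functions_subset_C1:
  assumes circ: "circular \<Omega>" and opn: "open \<Omega>" and f: "f \<in> C1_slice_functions \<Omega>"
  shows "f \<in> C1 \<Omega>"
proof -
  obtain F where F: "C1_stem_of \<Omega> f F"
    using f by (auto simp: C1_slice_functions_def)
  let ?B = "\<lambda>(v :: (real, 'a) vec) y. cl (0, v) * y"
  let ?g = "\<lambda>x. (fst \<circ> F) (axial_point x) + ?B (sgn (snd x)) ((snd \<circ> F) (axial_point x))"
  have B: "bounded_bilinear ?B"
    by (rule bounded_bilinear.comp1[OF bounded_bilinear_clifford_mult])
      (intro bounded_linear_compose[OF bounded_linear_cl] bounded_linear_Pair bounded_linear_zero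
        bounded_linear_ident)
  have "?g \<in> C1 (axial_point -` stem_domain \<Omega>)"
    by (rule C1_axially_symmetric[OF B open_stem_domain[OF circ opn] stem_domain_cnj[OF circ]])
      (use F in \<open>simp_all add: C1_stem_of_def stem_function_def comp_def\<close>)
  also have "axial_point -` stem_domain \<Omega> = \<Omega>"
    by (rule set_eqI) (simp add: circular_iff_axial_point[OF circ])
  finally have "?g \<in> C1 \<Omega>" .
  then show ?thesis
  proof (rule C1_cong[OF _ opn])
    fix x assume "x \<in> \<Omega>"
    then have z: "axial_point x \<in> stem_domain \<Omega>"
      using circular_iff_axial_point[OF circ] by blast
    obtain I where I: "I \<in> imag_units" "x = slice_map I (axial_point x)"
      "snd x \<noteq> 0 \<Longrightarrow> I = (0, sgn (snd x))"
      using paravector_in_slice by blast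
    have fx: "f x = fst (F (axial_point x)) + cl I * snd (F (axial_point x))"
      using C1_stem_of_slice_map[OF circ F I(1) z] I(2) by simp
    show "?g x = f x"
    proof (cases "snd x = 0")
      case True
      then have "cnj (axial_point x) = axial_point x"
        by (simp add: complex_eq_iff)
      then have "snd (F (axial_point x)) = - snd (F (axial_point x))"
        using F z unfolding C1_stem_of_def stem_function_def by metis
      then have "snd (F (axial_point x)) = 0"
        by (rule eq_uminus_imp_zero)
      then show ?thesis
        by (simp add: fx)
    next
      case False
      then show ?thesis
        using I(3) by (simp add: fx)
    qed
  qed
qed

section \<open>The representation formula\<close>

text \<open>
  The stem function is read off from one slice \<open>I\<close>. For every other unit \<open>J\<close>, both \<open>F\<^sub>1 + J F\<^sub>2\<close>
  and the slice of \<open>f\<close> along \<open>J\<close> are left holomorphic for \<open>J\<close>, and they agree at the real points,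
  which belong to all slices. The identity theorem on the connected stem domain makes them equal.
\<close>

lemma left_holomorphic_slices_imp_C1_slice_function:
  assumes circ: "circular \<Omega>" and opn: "open \<Omega>" and con: "connected \<Omega>"
    and real: "\<Omega> \<inter> real_paravectors \<noteq> {}"
    and hol: "\<And>I. I \<in> imag_units \<Longrightarrow> left_holomorphic (cl I) (stem_domain \<Omega>) (f \<circ> slice_map I)"
  shows "f \<in> C1_slice_functions \<Omega>"
proof -
  let ?D = "stem_domain \<Omega>"
  obtain I :: "'a paravector" where I: "I \<in> imag_units"
    using imag_units_nonempty by blast
  define F where "F = stem_of_slice (cl I) (f \<circ> slice_map I)"
  note D = open_stem_domain[OF circ opn] and cnj = stem_domain_cnj[OF circ]
  have stem: "stem_function ?D F"
    unfolding F_def by (rule stem_function_stem_of_slice)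
  have represent: "f (slice_map J z) = fst (F z) + cl J * snd (F z)" if J: "J \<in> imag_units"
      and z: "z \<in> ?D" for J z
  proof -
    have "(f \<circ> slice_map J) z = fst (F z) + cl J * snd (F z)"
      unfolding F_def
    proof (rule left_holomorphic_identity[OF hol[OF J] left_holomorphic_stem_of_slice[OF hol[OF I]
            cl_imag_unit_square[OF I] cl_imag_unit_square[OF J] D cnj] D
                connected_stem_domain[OF circ con real]
            stem_domain_meets_reals[OF circ real] _ z])
      fix w assume "w \<in> ?D \<inter> \<real>"
      then have "Im w = 0"
        by (simp add: complex_is_Real_iff)
      then have "cnj w = w" "slice_map I w = slice_map J w"
        by (simp_all add: complex_eq_iff slice_map_def)
      then show "(f \<circ> slice_map J) w = fst (stem_of_slice (cl I) (f \<circ> slice_map I) w) +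
          cl J * snd (stem_of_slice (cl I) (f \<circ> slice_map I) w)"
        by (simp add: stem_of_slice_def scaleR_2[symmetric])
    qed
    then show ?thesis by simp
  qed
  have "C1_stem_of \<Omega> f F"
    unfolding C1_stem_of_def
  proof (intro conjI ballI stem)
    show "fst \<circ> F \<in> C1 ?D" "snd \<circ> F \<in> C1 ?D"
      unfolding F_def by (intro stem_of_slice_C1 left_holomorphic_imp_C1[OF D hol[OF I]] cnj;
          assumption)+
    fix x assume x: "x \<in> \<Omega>"
    obtain J where J: "J \<in> imag_units" "x = slice_map J (axial_point x)"
      using paravector_in_slice by blast
    have z: "axial_point x \<in> ?D"
      using x circular_iff_axial_point[OF circ] by blast
    show "f x = induced_slice ?D F x"
      using represent[OF J(1) z] induced_slice_slice_map[OF stem J(1) z] J(2) by simp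
  qed
  then show ?thesis
    unfolding C1_slice_functions_def by blast
qed

section \<open>The equivalence of the seven conditions\<close>

text \<open>
  Off the real line the slice is left holomorphic because \<open>thetabar\<close> and \<open>dbar_slice\<close> agree
  there, and the real line is removable.
\<close>

lemma thetabar_zero_imp_left_holomorphic_slices:
  assumes circ: "circular \<Omega>" and opn: "open \<Omega>" and f: "f \<in> C0_slice \<Omega>" "f \<in> C1 (nonreal_part \<Omega>)"
    and zero: "\<forall>x\<in>nonreal_part \<Omega>. thetabar f x = 0" and I: "I \<in> imag_units"
  shows "left_holomorphic (cl I) (stem_domain \<Omega>) (f \<circ> slice_map I)"
proof (rule left_holomorphic_across_reals)
  let ?D = "stem_domain \<Omega>"
  show D: "open ?D"
    by (rule open_stem_domain[OF circ opn])
  show "continuous_on ?D (f \<circ> slice_map I)"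
  proof (rule continuous_on_compose)
    show "continuous_on ?D (slice_map I)"
      by (rule linear_continuous_on[OF bounded_linear_slice_map])
    have "slice_map I ` ?D \<subseteq> \<Omega> \<inter> slice_plane I"
      using circular_slice_iff[OF circ I] by (auto simp: slice_plane_def)
    then show "continuous_on (slice_map I ` ?D) f"
      using f(1) I unfolding C0_slice_def by (blast intro: continuous_on_subset)
  qed
  have nonreal: "slice_map I z \<in> nonreal_part \<Omega>" "Im z \<noteq> 0" if "z \<in> ?D - \<real>" for z
    using that circular_slice_iff[OF circ I, of z] I
    by (auto simp: nonreal_part_iff complex_is_Real_iff imag_units_iff)
  have "f \<circ> slice_map I \<in> C1 (?D - \<real>)"
    by (rule C1_compose[OF f(2) C1_bounded_linear[OF bounded_linear_slice_map]]) (use nonreal in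
        blast)
  moreover have "dbar_slice I f (slice_map I z) = 0" if z: "z \<in> ?D - \<real>" for z
  proof -
    obtain f' where "(f has_derivative f') (at (slice_map I z))"
      using C1_has_derivative[OF f(2) nonreal(1)[OF z]] by blast
    then show ?thesis
      using thetabar_slice_map[OF _ I nonreal(2)[OF z]] zero nonreal(1)[OF z] by metis
  qed
  ultimately show "left_holomorphic (cl I) (?D - \<real>) (f \<circ> slice_map I)"
    using dbar_slice_zero_iff_left_holomorphic[OF I open_Diff[OF D closed_complex_Reals]] by blast
qed

lemma slice_monogenic_imp_thetabar_zero:
  assumes f: "f \<in> slice_monogenic \<Omega>" and x: "x \<in> nonreal_part \<Omega>"
  shows "thetabar f x = 0"
proof -
  obtain I where I: "I \<in> imag_units" "x = slice_map I (axial_point x)"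
    using paravector_in_slice by blast
  have x': "x \<in> \<Omega>" "Im (axial_point x) \<noteq> 0"
    using x by (simp_all add: nonreal_part_iff)
  obtain f' where "(f has_derivative f') (at x)"
    using f C1_has_derivative[OF _ x'(1), of f] unfolding slice_monogenic_def by blast
  then have "thetabar f x = dbar_slice I f x"
    using thetabar_slice_map[OF _ I(1) x'(2)] I(2) by metis
  also have "\<dots> = 0"
  proof -
    have "x \<in> slice_plane I" unfolding slice_plane_def using I(2) by (rule range_eqI)
    then show ?thesis using f I(1) x'(1) unfolding slice_monogenic_def by blast
  qed
  finally show ?thesis .
qed

theorem theorem2p20:
  fixes \<Omega> :: "'n::{finite,linorder} paravector set"
    and f :: "'n paravector \<Rightarrow> 'n clifford"
  assumes "CARD('n) \<ge> 2"
    and "open \<Omega>" and "\<Omega> \<noteq> {}" and "connected \<Omega>" and "circular \<Omega>"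
    and "\<Omega> \<inter> real_paravectors \<noteq> {}"
  shows
    "(f \<in> slice_monogenic \<Omega> \<longleftrightarrow>
        f \<in> C1_slice \<Omega> \<and> (\<forall>I\<in>imag_units. \<forall>x\<in>\<Omega> \<inter> slice_plane I. dbar_slice I f x = 0)) \<and>
     (f \<in> slice_monogenic \<Omega> \<longleftrightarrow>
        f \<in> C0 \<Omega> \<and> f \<in> C1 (nonreal_part \<Omega>) \<and> (\<forall>x\<in>nonreal_part \<Omega>. thetabar f x = 0)) \<and>
     (f \<in> slice_monogenic \<Omega> \<longleftrightarrow>
        f \<in> C0_slice \<Omega> \<and> f \<in> C1 (nonreal_part \<Omega>) \<and> (\<forall>x\<in>nonreal_part \<Omega>. thetabar f x = 0)) \<and>
     (f \<in> slice_monogenic \<Omega> \<longleftrightarrow>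
        f \<in> C1 \<Omega> \<and> (\<forall>x\<in>nonreal_part \<Omega>. thetabar f x = 0)) \<and>
     (f \<in> slice_monogenic \<Omega> \<longleftrightarrow>
        f \<in> C1 \<Omega> \<and> (\<forall>x\<in>\<Omega>. global_op f x = 0)) \<and>
     (f \<in> slice_monogenic \<Omega> \<longleftrightarrow>
        f \<in> C1_slice_functions \<Omega> \<and> (\<forall>x\<in>\<Omega>. slice_deriv_conj \<Omega> f x = 0))"
    (is "(?a \<longleftrightarrow> ?a') \<and> (?a \<longleftrightarrow> ?b) \<and> (?a \<longleftrightarrow> ?b') \<and> (?a \<longleftrightarrow> ?c) \<and> (?a \<longleftrightarrow> ?d) \<and> (?a \<longleftrightarrow> ?e)")
proof -
  note opn = \<open>open \<Omega>\<close> and circ = \<open>circular \<Omega>\<close>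
  note slices = C1_slice_dbar_iff[OF circ opn, of f]
  have a_a': ?a' if ?a
    using that C1_imp_C1_slice[OF circ] unfolding slice_monogenic_def by blast
  have a'_e: ?e if ?a'
  proof -
    have "f \<in> C1_slice_functions \<Omega>"
      by (rule left_holomorphic_slices_imp_C1_slice_function[OF circ opn assms(4,6)])
        (use that slices in blast)
    then show ?e
      using that slice_deriv_conj_zero_iff[OF circ opn] by blast
  qed
  have e_a: ?a if ?e
    using that C1_slice_functions_subset_C1[OF circ opn] slice_deriv_conj_zero_iff[OF circ opn]
    unfolding slice_monogenic_def by blast
  have a_c: ?c if ?a
    using that slice_monogenic_imp_thetabar_zero unfolding slice_monogenic_def by blast
  have c_b: ?b if ?c
    using that C1_imp_continuous_on[of f \<Omega>] C1_subset[of f \<Omega> "nonreal_part \<Omega>"]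
    unfolding C0_def nonreal_part_def by blast
  have b_b': ?b' if ?b
    using that unfolding C0_def C0_slice_def by (blast intro: continuous_on_subset)
  have b'_a': ?a' if ?b'
    using that thetabar_zero_imp_left_holomorphic_slices[OF circ opn, of f] slices by blast
  have c_d: "?c \<longleftrightarrow> ?d"
    by (simp only: global_op_zero_iff)
  show ?thesis
    using a_a' a'_e e_a a_c c_b b_b' b'_a' c_d by argo
qed

end
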